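(* Let $T$ be a tree satisfying $\sigma(T) = \tau_{\mathrm{ind}}(T)$ and containing a critical edge. Then $$\mathrm{ex}(n, T^{3}) \le |\mathcal{S}(n,\sigma(T)-1)| \quad\text{for all sufficiently large } n.$$ In particular, if $T$ is a strongly edge-critical tree, then $\mathrm{ex}(n, T^{3}) = |\mathcal{S}(n,\sigma(T)-1)|$ for all sufficiently large $n$.
   Context: Graphs are simple; for a graph $F$, $|F|$ denotes its number of edges, and for $I\subseteq V(F)$, $F-I$ denotes the subgraph induced on $V(F)\setminus I$. The crosscut number is $\sigma(F)=\min\{|I|+|F-I| : I \text{ an independent set of } F\}$. The covering number $\tau(F)$ is the minimum size of $S\subseteq V(F)$ with $|S\cap e|\ge 1$ for every edge $e$. For a bipartite graph $F$, the independent covering number $\tau_{\mathrm{ind}}(F)$ is the minimum size of $S\subseteq V(F)$ with $|S\cap e|=1$ for every edge $e$. An edge $e$ of a tree $T$ is critical if $\sigma(T\setminus e)\le \sigma(T)-1$, where $T\setminus e$ is obtained by deleting the edge $e$ (keeping all vertices). A tree $T$ is strongly edge-critical if $\tau(T)=\sigma(T)=\tau_{\mathrm{ind}}(T)$ and $T$ contains a critical edge. A $3$-graph is a set of $3$-subsets (edges) of a finite vertex set. The expansion $F^3$ of a graph $F$ is the $3$-graph obtained by adding to each edge of $F$ a new vertex, different edges receiving different new vertices. For a family/3-graph $F^3$, $\mathrm{ex}(n,F^3)$ is the maximum number of edges in an $n$-vertex $3$-graph containing no copy of $F^3$. For integers $n\ge t\ge 0$, $\mathcal{S}(n,t)=\{e\in\binom{[n]}{3}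 : |e\cap[t]|\ge 1\}$. *)

theory Defs
  imports Main
begin

text \<open>A simple graph is a finite vertex set V with a set E of 2-element subsets of V.\<close>
definition simple_graph :: "'a set \<Rightarrow> 'a set set \<Rightarrow> bool" where
  "simple_graph V E \<longleftrightarrow> finite V \<and> (\<forall>e\<in>E. e \<subseteq> V \<and> card e = 2)"

definition adj_rel :: "'a set set \<Rightarrow> ('a \<times> 'a) set" where
  "adj_rel E = {(u, v). {u, v} \<in> E}"

definition graph_connected :: "'a set \<Rightarrow> 'a set set \<Rightarrow> bool" where
  "graph_connected V E \<longleftrightarrow> (\<forall>u\<in>V. \<forall>v\<in>V. (u, v) \<in> (adj_rel E)\<^sup>*)"

text \<open>Acyclic: no edge lies on a cycle, i.e. its endpoints are not joined by a path avoiding it.\<close>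
definition acyclic_graph :: "'a set set \<Rightarrow> bool" where
  "acyclic_graph E \<longleftrightarrow> (\<forall>e\<in>E. \<forall>u v. e = {u, v} \<longrightarrow> (u, v) \<notin> (adj_rel (E - {e}))\<^sup>*)"

definition is_tree :: "'a set \<Rightarrow> 'a set set \<Rightarrow> bool" where
  "is_tree V E \<longleftrightarrow> simple_graph V E \<and> V \<noteq> {} \<and> graph_connected V E \<and> acyclic_graph E"

definition independent_set :: "'a set \<Rightarrow> 'a set set \<Rightarrow> 'a set \<Rightarrow> bool" where
  "independent_set V E I \<longleftrightarrow> I \<subseteq> V \<and> (\<forall>e\<in>E. \<not> e \<subseteq> I)"

text \<open>Crosscut number: min over independent I of |I| + |F - I| (edges of the induced subgraph on V - I).\<close>
definition crosscut :: "'a set \<Rightarrow> 'a set set \<Rightarrow> nat" where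
  "crosscut V E = Min {card I + card {e\<in>E. e \<inter> I = {}} | I. independent_set V E I}"

definition cover_number :: "'a set \<Rightarrow> 'a set set \<Rightarrow> nat" where
  "cover_number V E = Min {card S | S. S \<subseteq> V \<and> (\<forall>e\<in>E. card (S \<inter> e) \<ge> 1)}"

definition ind_cover_number :: "'a set \<Rightarrow> 'a set set \<Rightarrow> nat" where
  "ind_cover_number V E = Min {card S | S. S \<subseteq> V \<and> (\<forall>e\<in>E. card (S \<inter> e) = 1)}"

text \<open>e is critical: sigma(T minus e) <= sigma(T) - 1 (written without nat truncation).\<close>
definition critical_edge :: "'a set \<Rightarrow> 'a set set \<Rightarrow> 'a set \<Rightarrow> bool" where
  "critical_edge V E e \<longleftrightarrow> e \<in> E \<and> crosscut V (E - {e}) + 1 \<le> crosscut V E"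

definition strongly_edge_critical :: "'a set \<Rightarrow> 'a set set \<Rightarrow> bool" where
  "strongly_edge_critical V E \<longleftrightarrow> is_tree V E \<and>
     cover_number V E = crosscut V E \<and> crosscut V E = ind_cover_number V E \<and>
     (\<exists>e\<in>E. critical_edge V E e)"

text \<open>H (a 3-graph on nat) contains a copy of the expansion F^3: injective f on V(F), and
  distinct new vertices g e outside f(V), with f(e) plus g e an edge of H.\<close>
definition contains_expansion :: "nat set set \<Rightarrow> 'a set \<Rightarrow> 'a set set \<Rightarrow> bool" where
  "contains_expansion H V E \<longleftrightarrow> (\<exists>f g. inj_on f V \<and> inj_on g E \<and> (\<forall>e\<in>E. g e \<notin> f ` V) \<and>
      (\<forall>e\<in>E. insert (g e) (f ` e) \<in> H))"

definition triples :: "nat \<Rightarrow> nat set set" where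
  "triples n = {e. e \<subseteq> {1..n} \<and> card e = 3}"

definition ex_exp3 :: "nat \<Rightarrow> 'a set \<Rightarrow> 'a set set \<Rightarrow> nat" where
  "ex_exp3 n V E = Max {card H | H. H \<subseteq> triples n \<and> \<not> contains_expansion H V E}"

definition star3 :: "nat \<Rightarrow> nat \<Rightarrow> nat set set" where
  "star3 n t = {e \<in> triples n. e \<inter> {1..t} \<noteq> {}}"

end

theory Submission
  imports Defs Complex_Main "HOL-Library.FuncSet"
begin

text \<open>
Write sigma(T) = t + 1. Counting the edges at the independent cover A of size t + 1 shows that a
critical edge can only exist if A contains a leaf a; hence T is embedded by sending A - {a} to a
set L of t vertices that is joined by heavy pairs (pairs of large codegree) to almost everything,
and using a single triple disjoint from L for the pendant edge at a.

In a 3-graph H free of the expansion, the heavy pairs form a graph without a copy of T, so there are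
only O(n) of them and they span only O(n) triangles. The pairs of codegree at least t + 1 number
o(n^2): otherwise they contain a large complete bipartite graph, whose lists of t + 1 completing
vertices can be put in canonical form (each entry constant, depending on one side only, or on both
sides), and T is embedded greedily. Counting triples by their light pairs then gives
|H| <= (t/2 + o(1)) n^2, and near equality forces almost all pairs to have t common heavy
neighbours, which produces the set L. A triple avoiding L cannot meet a vertex that is heavily joined
to L, and each of the remaining r vertices (r at most a small multiple of n) loses linearly many
triples through L, which outweighs the O(r^2) triples among them.
\<close>

section \<open>Trees as graphs grown by leaves\<close>

text \<open>New vertices can be chosen greedily for every pair with \<open>card V + card E\<close>
  completions, so this number is the threshold \<open>K\<close> for heavy pairs. The obstacle is the
  pairs with at least t + 1 but fewer than K completions: their lists have bounded size and may all
  coincide, as they do outside the centres of a star with t + 1 centres, so distinct new vertices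
  need not exist. The remedy is that a completion shared by all lists can host a vertex of A; on the
  edges at that vertex the roles reverse, and a vertex of the biclique serves as the new vertex.
  Since the lists have exactly \<open>card A\<close> entries, the vertices of A left over are as
  many as the list entries outside the shared part. The equality sigma(T) = tau_ind(T) enters only
  by providing an independent cover A with |A| = sigma(T) > sigma(T - e0) for a critical edge e0.
  The exact bound is reached by contradiction: if H beats the star, then |H| >= t (n choose 2) -
  O(n), and the constants are chosen backwards from the final comparison, which tolerates n / (12
  K^2) exceptional vertices.\<close>

inductive grown :: "'a set \<Rightarrow> 'a set set \<Rightarrow> bool" where
  single: "grown {v} {}"
| leaf: "\<lbrakk>grown V E; u \<in> V; w \<notin> V\<rbrakk> \<Longrightarrow> grown (insert w V) (insert {u, w} E)"

lemma grown_finite: "grown V E \<Longrightarrow> finite V \<and> finite E"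
  by (induction rule: grown.induct) auto

lemma grown_edge_sub: "grown V E \<Longrightarrow> e \<in> E \<Longrightarrow> e \<subseteq> V \<and> card e = 2"
  by (induction rule: grown.induct) (auto simp: card_insert_if)

lemma grown_edgeE:
  assumes "grown V E" "e \<in> E"
  obtains u v where "e = {u, v}" "u \<noteq> v" "u \<in> V" "v \<in> V"
  using grown_edge_sub[OF assms] by (metis card_2_iff insert_subset)

lemma sym_adj_rel: "sym (adj_rel E)"
  by (auto simp: adj_rel_def sym_def insert_commute)

lemma grown_connected:
  assumes "grown V E" "x \<in> V" "y \<in> V"
  shows "(x, y) \<in> (adj_rel E)\<^sup>*"
proof -
  have "\<exists>r\<in>V. \<forall>v\<in>V. (r, v) \<in> (adj_rel E)\<^sup>*"
    using assms(1)
  proof (induction rule: grown.induct)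
    case (leaf V E u w)
    then obtain r where r: "r \<in> V" "\<And>v. v \<in> V \<Longrightarrow> (r, v) \<in> (adj_rel E)\<^sup>*" by blast
    have "adj_rel E \<subseteq> adj_rel (insert {u, w} E)" by (auto simp: adj_rel_def)
    then have "(r, v) \<in> (adj_rel (insert {u, w} E))\<^sup>*" if "v \<in> V" for v
      using r(2)[OF that] rtrancl_mono by blast
    moreover have "(u, w) \<in> adj_rel (insert {u, w} E)" by (auto simp: adj_rel_def)
    ultimately have "(r, v) \<in> (adj_rel (insert {u, w} E))\<^sup>*" if "v \<in> insert w V" for v
      using that leaf.hyps(2) by (metis insertE rtrancl.rtrancl_into_rtrancl)
    then show ?case using r(1) by blast
  qed simp
  then obtain r where r: "(r, x) \<in> (adj_rel E)\<^sup>*" "(r, y) \<in> (adj_rel E)\<^sup>*" using assms by blast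
  then show ?thesis
    by (meson sym_adj_rel symD sym_rtrancl rtrancl_trans)
qed

lemma finite_has_maximal_card:
  assumes "finite C" "C \<noteq> {}"
  shows "\<exists>X\<in>C. \<forall>Y\<in>C. card Y \<le> card X"
proof -
  have "Max (card ` C) \<in> card ` C" using assms by (intro Max_in) auto
  then obtain X where "X \<in> C" "card X = Max (card ` C)" by auto
  then show ?thesis using assms by (intro bexI[of _ X]) (auto intro: Max_ge)
qed

text \<open>Take a grown subgraph with as many vertices as possible. Connectivity would let it
  absorb a vertex across its boundary, so it spans V; an edge of E that it misses would join two
  vertices already linked by a path avoiding that edge, against acyclicity. From here on, induction
  along \<open>grown\<close> replaces the conditions of \<open>is_tree\<close>.\<close>

lemma tree_grown:
  assumes "is_tree V E"
  shows "grown V E"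
proof -
  have fin: "finite V" and ed: "\<And>e. e \<in> E \<Longrightarrow> e \<subseteq> V \<and> card e = 2" and ne: "V \<noteq> {}"
    and con: "graph_connected V E" and ac: "acyclic_graph E"
    using assms by (auto simp: is_tree_def simple_graph_def)
  define Q where "Q V' \<longleftrightarrow> (\<exists>E'\<subseteq>E. V' \<subseteq> V \<and> grown V' E')" for V'
  obtain v0 where "v0 \<in> V" using ne by blast
  then have "Q {v0}" unfolding Q_def by (intro exI[of _ "{}"]) (simp add: grown.single)
  then have "Collect Q \<noteq> {}" by auto
  moreover have "finite (Collect Q)"
    by (rule finite_subset[of _ "Pow V"]) (use fin in \<open>auto simp: Q_def\<close>)
  ultimately have "\<exists>X\<in>Collect Q. \<forall>Y\<in>Collect Q. card Y \<le> card X"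
    by (intro finite_has_maximal_card)
  then obtain V' where V': "Q V'" and mx: "\<And>V''. Q V'' \<Longrightarrow> card V'' \<le> card V'"
    by auto
  obtain E' where E': "E' \<subseteq> E" "V' \<subseteq> V" "grown V' E'" using V' Q_def by blast
  have V'ne: "V' \<noteq> {}" using E'(3) by (cases) auto
  have "V' = V"
  proof (rule ccontr)
    assume "V' \<noteq> V"
    then obtain y where y: "y \<in> V" "y \<notin> V'" using E' by blast
    obtain x where x: "x \<in> V'" using V'ne by blast
    have "(x, y) \<in> (adj_rel E)\<^sup>*" using con x y E' by (auto simp: graph_connected_def)
    then have "\<exists>u w. u \<in> V' \<and> w \<notin> V' \<and> {u, w} \<in> E"
      using x y(2)
    proof (induction rule: rtrancl_induct)
      case (step y z)
      then show ?case by (cases "y \<in> V'") (auto simp: adj_rel_def)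
    qed simp
    then obtain u w where uw: "u \<in> V'" "w \<notin> V'" "{u, w} \<in> E" by blast
    have "grown (insert w V') (insert {u, w} E')" using grown.leaf[OF E'(3) uw(1,2)] .
    moreover have "insert w V' \<subseteq> V" using ed[OF uw(3)] E'(2) by auto
    ultimately have "Q (insert w V')" unfolding Q_def using E'(1) uw(3) by (metis insert_subset)
    from mx[OF this] show False
      using uw(2) E'(3) grown_finite by fastforce
  qed
  moreover have "E' = E"
  proof (rule ccontr)
    assume "E' \<noteq> E"
    then obtain e where e: "e \<in> E" "e \<notin> E'" using E' by blast
    then obtain x y where xy: "e = {x, y}" "x \<in> V" "y \<in> V"
      using ed[OF e(1)] by (auto simp: card_2_iff)
    have "(x, y) \<in> (adj_rel E')\<^sup>*" using grown_connected[OF E'(3)] xy \<open>V' = V\<close> by blast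
    moreover have "adj_rel E' \<subseteq> adj_rel (E - {e})" using e E' by (auto simp: adj_rel_def)
    ultimately have "(x, y) \<in> (adj_rel (E - {e}))\<^sup>*" using rtrancl_mono by blast
    then show False using ac e(1) xy(1) by (auto simp: acyclic_graph_def)
  qed
  ultimately show ?thesis using E' by simp
qed

text \<open>The last attached vertex w lies on one edge only, so removing it from U costs at most
  that edge. The gap of 1 between edges and vertices of a forest is what later pays for the deleted
  critical edge.\<close>

lemma grown_induced_card:
  assumes "grown V E" "U \<subseteq> V" "U \<noteq> {}"
  shows "card {e\<in>E. e \<subseteq> U} + 1 \<le> card U"
  using assms
proof (induction arbitrary: U rule: grown.induct)
  case (single v)
  then have "U = {v}" by auto
  then show ?case by simp
next
  case (leaf V E u w)
  have fin: "finite U" using leaf.prems(1) grown_finite[OF leaf.hyps(1)] finite_subset by blast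
  have finE: "finite E" using grown_finite[OF leaf.hyps(1)] by simp
  have sub: "e \<subseteq> V" if "e \<in> E" for e using grown_edge_sub[OF leaf.hyps(1) that] by simp
  have edne: "{} \<notin> E" using grown_edge_sub[OF leaf.hyps(1), of "{}"] by auto
  show ?case
  proof (cases "w \<in> U")
    case False
    then have "{e \<in> insert {u, w} E. e \<subseteq> U} = {e \<in> E. e \<subseteq> U}" by auto
    then show ?thesis using leaf.IH[of U] leaf.prems False by auto
  next
    case True
    have inc: "{e \<in> insert {u, w} E. e \<subseteq> U} \<subseteq> insert {u, w} {e \<in> E. e \<subseteq> U - {w}}"
      using sub leaf.hyps(3) by auto
    show ?thesis
    proof (cases "U = {w}")
      case True
      then have "{e \<in> insert {u, w} E. e \<subseteq> U} = {}"
        using leaf.hyps(2,3) sub edne by (auto simp: subset_singleton_iff)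
      moreover have "card U = 1" using True by simp
      ultimately show ?thesis by (simp only: card.empty)
    next
      case False
      then have "card {e \<in> E. e \<subseteq> U - {w}} + 1 \<le> card (U - {w})"
        using leaf.IH[of "U - {w}"] leaf.prems True by auto
      moreover have "card {e \<in> insert {u, w} E. e \<subseteq> U} \<le> card {e \<in> E. e \<subseteq> U - {w}} + 1"
        using card_mono[OF _ inc] finE by (simp add: card_insert_if split: if_splits)
      moreover have "card U = card (U - {w}) + 1"
        using True fin by (metis Suc_eq_plus1 card_Suc_Diff1)
      ultimately show ?thesis by simp
    qed
  qed
qed

text \<open>Each edge is charged to the vertex that was attached together with it. This lets every
  edge draw its new vertex from a supply owned by one endpoint, with no supply used twice.\<close>

lemma grown_orientation:
  assumes "grown V E"
  shows "\<exists>c. inj_on c E \<and> (\<forall>e\<in>E. c e \<in> e)"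
  using assms
proof (induction rule: grown.induct)
  case (leaf V E u w)
  then obtain c where c: "inj_on c E" "\<forall>e\<in>E. c e \<in> e" by blast
  have sub: "e \<subseteq> V" if "e \<in> E" for e using grown_edge_sub[OF leaf.hyps(1) that] by simp
  have "{u, w} \<notin> E" using sub leaf.hyps(3) by blast
  moreover have "w \<notin> c ` E" using c(2) sub leaf.hyps(3) by blast
  ultimately have "inj_on (c({u, w} := w)) (insert {u, w} E)"
    using c(1) by (auto simp: inj_on_def)
  moreover have "\<forall>e\<in>insert {u, w} E. (c({u, w} := w)) e \<in> e" using c(2) by auto
  ultimately show ?case by blast
qed simp

text \<open>A colour class of the bipartition. It ensures that the minimum in
  \<open>ind_cover_number\<close> is taken over a nonempty set.\<close>

lemma grown_ind_cover:
  assumes "grown V E"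
  shows "\<exists>S\<subseteq>V. \<forall>e\<in>E. card (S \<inter> e) = 1"
  using assms
proof (induction rule: grown.induct)
  case (leaf V E u w)
  then obtain S where S: "S \<subseteq> V" "\<forall>e\<in>E. card (S \<inter> e) = 1" by blast
  have sub: "e \<subseteq> V" if "e \<in> E" for e using grown_edge_sub[OF leaf.hyps(1) that] by simp
  show ?case
  proof (cases "u \<in> S")
    case True
    then have "S \<inter> {u, w} = {u}" using S leaf.hyps by auto
    then show ?thesis using S by (intro exI[of _ S]) auto
  next
    case False
    have "insert w S \<inter> e = S \<inter> e" if "e \<in> E" for e using sub[OF that] leaf.hyps by auto
    moreover have "insert w S \<inter> {u, w} = {w}" using False leaf.hyps S by auto
    ultimately have "\<forall>e\<in>insert {u, w} E. card (insert w S \<inter> e) = 1"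
      using S by (metis insertE is_singletonI is_singleton_altdef)
    then show ?thesis using S by (intro exI[of _ "insert w S"]) auto
  qed
qed auto

section \<open>Optimal covers and crosscuts, and the leaf forced by a critical edge\<close>

lemma ind_cover_attained:
  assumes "grown V E"
  shows "\<exists>S\<subseteq>V. (\<forall>e\<in>E. card (S \<inter> e) = 1) \<and> card S = ind_cover_number V E"
proof -
  let ?C = "{card S | S. S \<subseteq> V \<and> (\<forall>e\<in>E. card (S \<inter> e) = 1)}"
  have "finite ?C" by (rule finite_subset[of _ "card ` Pow V"]) (use grown_finite[OF assms] in auto)
  moreover have "?C \<noteq> {}" using grown_ind_cover[OF assms] by blast
  ultimately have "Min ?C \<in> ?C" by (rule Min_in)
  then show ?thesis unfolding ind_cover_number_def by auto
qed

lemma crosscut_attained: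
  assumes "finite V" "finite E" "\<And>e. e \<in> E \<Longrightarrow> e \<noteq> {}"
  shows "\<exists>I. independent_set V E I \<and> crosscut V E = card I + card {e\<in>E. e \<inter> I = {}}"
proof -
  let ?C = "{card I + card {e\<in>E. e \<inter> I = {}} | I. independent_set V E I}"
  have "finite ?C"
    by (rule finite_subset[of _ "(\<lambda>I. card I + card {e\<in>E. e \<inter> I = {}}) ` Pow V"])
       (use assms in \<open>auto simp: independent_set_def\<close>)
  moreover have "independent_set V E {}" using assms(3) by (auto simp: independent_set_def)
  then have "?C \<noteq> {}" by blast
  ultimately have "Min ?C \<in> ?C" by (rule Min_in)
  then show ?thesis unfolding crosscut_def by auto
qed

lemma ind_cover_edge:
  assumes "grown V E" "e \<in> E" "card (A \<inter> e) = 1"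
  shows "\<exists>a b. e = {a, b} \<and> a \<in> A \<and> b \<in> V - A"
proof -
  obtain u v where uv: "e = {u, v}" "u \<noteq> v" "u \<in> V" "v \<in> V"
    by (rule grown_edgeE[OF assms(1,2)])
  from assms(3) obtain z where "A \<inter> e = {z}" by (meson card_1_singletonE)
  then show ?thesis
    using uv by (metis (no_types, lifting) DiffI Int_iff insertCI insert_commute insertE singletonD)
qed

text \<open>If all degrees in A were at least 2, then for an optimal independent set I of T - e0 the at least
  2|A - I| edges at A - I could not be accounted for: the forest induced on the symmetric difference
  of A and I is too small, so the crosscut number of T - e0 would be at least |A|.\<close>

lemma ind_cover_has_leaf:
  assumes g: "grown V E" and A: "A \<subseteq> V" "\<And>e. e \<in> E \<Longrightarrow> card (A \<inter> e) = 1"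
    and crit: "e0 \<in> E" "crosscut V (E - {e0}) < card A"
  shows "\<exists>a\<in>A. \<exists>b. {e\<in>E. a \<in> e} = {{a, b}} \<and> b \<in> V - A"
proof -
  have fin: "finite V" "finite E" using grown_finite[OF g] by auto
  have finA: "finite A" using A(1) fin finite_subset by blast
  have eA: "\<exists>a b. e = {a, b} \<and> a \<in> A \<and> b \<in> V - A" if "e \<in> E" for e
    using ind_cover_edge[OF g that A(2)[OF that]] .
  \<comment> \<open>No vertex is isolated: the edge \<open>e0\<close> exists, and a path from a to
    one of its ends has to leave a along an edge.\<close>
  have Eincident: "{e\<in>E. a \<in> e} \<noteq> {}" if "a \<in> A" for a
  proof
    assume em: "{e\<in>E. a \<in> e} = {}"
    obtain u v where uv: "e0 = {u, v}" "u \<noteq> v" "u \<in> V" "v \<in> V" using grown_edgeE[OF g crit(1)] by blast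
    have "a \<noteq> u" using em crit(1) uv by blast
    have "(a, u) \<in> (adj_rel E)\<^sup>*" using grown_connected[OF g] that A uv by blast
    then obtain y where "(a, y) \<in> adj_rel E" using \<open>a \<noteq> u\<close> by (meson converse_rtranclE)
    then show False using em by (auto simp: adj_rel_def)
  qed
  have fini: "finite {e\<in>E. a \<in> e}" for a using fin by simp
  have "\<exists>a\<in>A. card {e\<in>E. a \<in> e} < 2"
  proof (rule ccontr)
    assume "\<not> ?thesis"
    then have deg: "card {e\<in>E. a \<in> e} \<ge> 2" if "a \<in> A" for a using that by auto
    obtain I where I: "independent_set V (E - {e0}) I"
      "crosscut V (E - {e0}) = card I + card {e\<in>E - {e0}. e \<inter> I = {}}"
      using crosscut_attained[of V "E - {e0}"] fin grown_edge_sub[OF g] by fastforce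
    have IV: "I \<subseteq> V" using I(1) by (simp add: independent_set_def)
    then have finI: "finite I" using fin finite_subset by blast
    define U where "U = (A - I) \<union> (I - A)"
    define F where "F = {e\<in>E. \<exists>a\<in>A - I. a \<in> e}"
    have "card F = (\<Sum>a\<in>A - I. card {e\<in>E. a \<in> e})"
    proof -
      have "F = (\<Union>a\<in>A - I. {e\<in>E. a \<in> e})" unfolding F_def by auto
      moreover have "{e\<in>E. a \<in> e} \<inter> {e\<in>E. a' \<in> e} = {}" if "a \<in> A" "a' \<in> A" "a \<noteq> a'" for a a'
        using eA that by fastforce
      ultimately show ?thesis using finA fini by (subst card_UN_disjoint[symmetric]) auto
    qed
    moreover have "(\<Sum>a\<in>A - I. card {e\<in>E. a \<in> e}) \<ge> (\<Sum>a\<in>A - I. 2)"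
      by (rule sum_mono) (use deg in auto)
    ultimately have F1: "card F \<ge> 2 * card (A - I)" by simp
    \<comment> \<open>The A-endpoint of such an edge is outside I. If the other endpoint is in I,
      both lie in the symmetric difference U; otherwise the edge avoids I and is paid for by the
      crosscut value, unless it is \<open>e0\<close>.\<close>
    have "F \<subseteq> {e\<in>E. e \<subseteq> U} \<union> {e\<in>E - {e0}. e \<inter> I = {}} \<union> {e0}"
    proof
      fix e assume "e \<in> F"
      then obtain a where a: "e \<in> E" "a \<in> A" "a \<notin> I" "a \<in> e" by (auto simp: F_def)
      then obtain b where b: "e = {a, b}" "b \<in> V - A" using eA[OF a(1)] by fastforce
      then show "e \<in> {e\<in>E. e \<subseteq> U} \<union> {e\<in>E - {e0}. e \<inter> I = {}} \<union> {e0}"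
        using a by (cases "b \<in> I") (auto simp: U_def)
    qed
    then have "card F \<le> card ({e\<in>E. e \<subseteq> U} \<union> {e\<in>E - {e0}. e \<inter> I = {}} \<union> {e0})"
      by (rule card_mono[rotated]) (use fin in auto)
    also have "\<dots> \<le> card {e\<in>E. e \<subseteq> U} + card {e\<in>E - {e0}. e \<inter> I = {}} + 1"
      by (metis (no_types, lifting) One_nat_def add_mono card.empty card_Un_le card_insert_disjoint
          empty_iff finite.emptyI le_trans order_refl)
    finally have F2: "card F \<le> card {e\<in>E. e \<subseteq> U} + card {e\<in>E - {e0}. e \<inter> I = {}} + 1" .
    have cU: "card U = card (A - I) + card (I - A)"
      unfolding U_def using finA finI by (intro card_Un_disjoint) auto
    have cA: "card A = card (A \<inter> I) + card (A - I)"
      using finA by (metis card_Int_Diff)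
    have cI: "card I = card (A \<inter> I) + card (I - A)"
      using finI by (metis card_Int_Diff inf_commute)
    show False
    proof (cases "U = {}")
      case True
      then have "A = I" by (auto simp: U_def)
      then show False using I(2) crit(2) by simp
    next
      case False
      \<comment> \<open>The -1 of the forest bound cancels the +1 for \<open>e0\<close>: with c the
        number of edges of E - {e0} missing I, 2|A - I| <= |A - I| + |I - A| + c, that is |A| <= |I|
        + c, contrary to \<open>crit(2)\<close>.\<close>
      have "U \<subseteq> V" using A IV by (auto simp: U_def)
      from grown_induced_card[OF g this False] F1 F2 cU cA cI I(2) crit(2) show False by linarith
    qed
  qed
  then obtain a where a: "a \<in> A" "card {e\<in>E. a \<in> e} < 2" by blast
  moreover have "card {e\<in>E. a \<in> e} \<noteq> 0" using Eincident[OF a(1)] fini by simp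
  ultimately have "card {e\<in>E. a \<in> e} = 1" by linarith
  then obtain e where e: "{e\<in>E. a \<in> e} = {e}" by (meson card_1_singletonE)
  then have "e \<in> E" "a \<in> e" by auto
  then obtain b where "e = {a, b}" "b \<in> V - A" using eA[of e] a(1) by fastforce
  then show ?thesis using a(1) e by blast
qed

section \<open>The lower bound: a star avoids the expansion\<close>

lemma cover_number_le:
  assumes "finite V" "S \<subseteq> V" "\<And>e. e \<in> E \<Longrightarrow> S \<inter> e \<noteq> {}"
  shows "cover_number V E \<le> card S"
proof -
  let ?C = "{card S | S. S \<subseteq> V \<and> (\<forall>e\<in>E. card (S \<inter> e) \<ge> 1)}"
  have "finite ?C" by (rule finite_subset[of _ "card ` Pow V"]) (use assms in auto)
  moreover have "card (S \<inter> e) \<ge> 1" if "e \<in> E" for e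
    using assms(3)[OF that] assms(1,2) by (metis One_nat_def Suc_leI card_gt_0_iff finite_Int finite_subset)
  then have "card S \<in> ?C" using assms by blast
  ultimately show ?thesis unfolding cover_number_def by (rule Min_le)
qed

text \<open>A copy inside the star pulls {1..t} back to a vertex cover of size at most t: a label
  \<open>f v\<close> is sent to v, and a label \<open>g e\<close> to some endpoint of e. Every edge
  of T is hit because its triple meets {1..t}.\<close>

lemma star3_no_expansion:
  assumes g: "grown V E" and t: "t < cover_number V E"
  shows "\<not> contains_expansion (star3 n t) V E"
proof
  assume "contains_expansion (star3 n t) V E"
  then obtain f g where fg: "inj_on f V" "inj_on g E" "\<And>e. e \<in> E \<Longrightarrow> g e \<notin> f ` V"
    "\<And>e. e \<in> E \<Longrightarrow> insert (g e) (f ` e) \<in> star3 n t"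
    unfolding contains_expansion_def by blast
  define pick where "pick l = (if l \<in> f ` V then inv_into V f l else (SOME u. u \<in> inv_into E g l))" for l
  define S where "S = pick ` ({1..t} \<inter> (f ` V \<union> g ` E))"
  have sub: "e \<subseteq> V \<and> e \<noteq> {}" if "e \<in> E" for e using grown_edge_sub[OF assms(1) that] by auto
  have pf: "pick (f v) = v" if "v \<in> V" for v using that fg(1) by (simp add: pick_def)
  have pg: "pick (g e) \<in> e" if "e \<in> E" for e
  proof -
    have "pick (g e) = (SOME u. u \<in> e)" using that fg(2,3) by (simp add: pick_def)
    then show ?thesis using sub[OF that] some_in_eq by auto
  qed
  have "S \<subseteq> V" unfolding S_def using pf pg sub by fastforce
  moreover have "S \<inter> e \<noteq> {}" if e: "e \<in> E" for e
  proof -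
    have "insert (g e) (f ` e) \<inter> {1..t} \<noteq> {}" using fg(4)[OF e] by (simp add: star3_def)
    then consider "g e \<in> {1..t}" | v where "v \<in> e" "f v \<in> {1..t}" by blast
    then show ?thesis
    proof cases
      case 1
      then have "pick (g e) \<in> S" using e by (auto simp: S_def)
      then show ?thesis using pg[OF e] by blast
    next
      case 2
      then have "v \<in> V" using sub[OF e] by blast
      then have "v \<in> S" using 2 pf[of v] unfolding S_def by (metis IntI UnI1 image_eqI)
      then show ?thesis using 2 by blast
    qed
  qed
  ultimately have "cover_number V E \<le> card S"
    using cover_number_le grown_finite[OF assms(1)] by blast
  also have "\<dots> \<le> card ({1..t} \<inter> (f ` V \<union> g ` E))" unfolding S_def by (rule card_image_le) simp
  also have "\<dots> \<le> card {1..t}" by (rule card_mono) auto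
  finally show False using t by simp
qed

section \<open>Sunflowers and representatives\<close>

text \<open>Each list still has a free element after the forbidden set F and all earlier choices are
  removed, so no appeal to Hall's theorem is needed.\<close>

lemma greedy_representatives:
  assumes "finite S" "finite F" "\<And>e. e \<in> S \<Longrightarrow> finite (L e) \<and> card F + card S \<le> card (L e)"
  shows "\<exists>g. inj_on g S \<and> (\<forall>e\<in>S. g e \<in> L e - F)"
  using assms
proof (induction arbitrary: F rule: finite_induct)
  case (insert x S)
  have "finite (L x)" and "card F < card (L x)" using insert.prems(2)[of x] insert.hyps by auto
  then have "\<not> L x \<subseteq> F" using card_mono[OF insert.prems(1), of "L x"] by linarith
  then obtain w where w: "w \<in> L x" "w \<notin> F" by blast
  have "\<exists>g. inj_on g S \<and> (\<forall>e\<in>S. g e \<in> L e - insert w F)"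
    by (rule insert.IH) (use insert.prems insert.hyps w in auto)
  then obtain g where g: "inj_on g S" "\<forall>e\<in>S. g e \<in> L e - insert w F" by blast
  have "inj_on (g(x := w)) (insert x S)" using g insert.hyps by (auto simp: inj_on_def)
  moreover have "\<forall>e\<in>insert x S. (g(x := w)) e \<in> L e - F" using g w by auto
  ultimately show ?case by blast
qed simp

lemma pigeonhole_fiber:
  assumes "finite Y" "\<phi> ` Y \<subseteq> C" "finite C" "card C * s < card Y"
  shows "\<exists>c. s < card {y\<in>Y. \<phi> y = c}"
proof (rule ccontr)
  assume "\<not> ?thesis"
  then have le: "card {y\<in>Y. \<phi> y = c} \<le> s" for c by (simp add: not_less)
  have "Y = (\<Union>c\<in>C. {y\<in>Y. \<phi> y = c})" using assms(2) by auto
  then have "card Y \<le> (\<Sum>c\<in>C. card {y\<in>Y. \<phi> y = c})" using card_UN_le[OF assms(3)] by metis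
  also have "\<dots> \<le> (\<Sum>c\<in>C. s)" by (rule sum_mono) (rule le)
  finally show False using assms(4) by simp
qed

text \<open>Peel off a vertex with at most k neighbours in the remaining set: this destroys at most
  k edges and at most k * k triangles.\<close>

lemma degenerate_card:
  assumes "finite U" and two: "\<And>p. p \<in> G \<Longrightarrow> card p = 2"
    and deg: "\<And>S. S \<subseteq> U \<Longrightarrow> S \<noteq> {} \<Longrightarrow> \<exists>v\<in>S. card {u\<in>S. {u, v} \<in> G} \<le> k"
  shows "card {p\<in>G. p \<subseteq> U} \<le> k * card U \<and>
    card {e. e \<subseteq> U \<and> card e = 3 \<and> (\<forall>p\<subseteq>e. card p = 2 \<longrightarrow> p \<in> G)} \<le> k * k * card U"
proof -
  define Tr where "Tr S = {e. e \<subseteq> S \<and> card e = 3 \<and> (\<forall>p\<subseteq>e. card p = 2 \<longrightarrow> p \<in> G)}" for S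
  have "S \<subseteq> U \<Longrightarrow> card {p\<in>G. p \<subseteq> S} \<le> k * card S \<and> card (Tr S) \<le> k * k * card S" for S
  proof (induction "card S" arbitrary: S)
    case 0
    then have "S = {}" using assms(1) finite_subset by fastforce
    moreover have "{p\<in>G. p \<subseteq> {}} = {}" using two by fastforce
    moreover have "Tr {} = {}" by (auto simp: Tr_def)
    ultimately show ?case by simp
  next
    case (Suc n)
    have finS: "finite S" using Suc assms(1) finite_subset by blast
    from Suc obtain v where v: "v \<in> S" "card {u\<in>S. {u, v} \<in> G} \<le> k" using deg[of S] by fastforce
    define N where "N = {u\<in>S. {u, v} \<in> G}"
    have finN: "finite N" using finS by (simp add: N_def)
    have cS: "card S = Suc (card (S - {v}))" using v finS by (metis card_Suc_Diff1)
    have IH: "card {p\<in>G. p \<subseteq> S - {v}} \<le> k * card (S - {v})" "card (Tr (S - {v})) \<le> k * k * card (S - {v})"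
      using Suc.hyps(1)[of "S - {v}"] Suc.hyps(2) Suc.prems cS by auto
    have "{p\<in>G. p \<subseteq> S} \<subseteq> {p\<in>G. p \<subseteq> S - {v}} \<union> (\<lambda>u. {u, v}) ` N"
    proof
      fix p assume p: "p \<in> {p\<in>G. p \<subseteq> S}"
      show "p \<in> {p\<in>G. p \<subseteq> S - {v}} \<union> (\<lambda>u. {u, v}) ` N"
      proof (cases "v \<in> p")
        case True
        then obtain u where "p = {u, v}" using two[of p] p by (auto simp: card_2_iff)
        then show ?thesis using p by (auto simp: N_def)
      qed (use p in auto)
    qed
    then have "card {p\<in>G. p \<subseteq> S} \<le> card ({p\<in>G. p \<subseteq> S - {v}} \<union> (\<lambda>u. {u, v}) ` N)"
      by (rule card_mono[rotated]) (use finS finN in \<open>auto intro: finite_subset[of _ "Pow S"]\<close>)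
    also have "\<dots> \<le> card {p\<in>G. p \<subseteq> S - {v}} + card N"
      by (meson add_left_mono card_Un_le card_image_le finN le_trans)
    finally have e: "card {p\<in>G. p \<subseteq> S} \<le> k * card S" using IH v(2) cS by (simp add: N_def)
    \<comment> \<open>A triangle through v is recorded by an ordered pair of neighbours of v, whence
      the crude k * k.\<close>
    have "Tr S \<subseteq> Tr (S - {v}) \<union> (\<lambda>(u, w). {u, w, v}) ` (N \<times> N)"
    proof
      fix e assume e: "e \<in> Tr S"
      show "e \<in> Tr (S - {v}) \<union> (\<lambda>(u, w). {u, w, v}) ` (N \<times> N)"
      proof (cases "v \<in> e")
        case True
        have "card (e - {v}) = 2" using e True by (simp add: Tr_def)
        then obtain u w where uw: "e - {v} = {u, w}" "u \<noteq> w" by (auto simp: card_2_iff)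
        then have e3: "e = {u, w, v}" "u \<noteq> v" "w \<noteq> v" using True by auto
        have "card {u, v} = 2" "card {w, v} = 2" "{u, v} \<subseteq> e" "{w, v} \<subseteq> e" using e3 by auto
        then have "u \<in> N" "w \<in> N" using e e3 by (auto simp: Tr_def N_def)
        then show ?thesis using e3 by auto
      next
        case False
        then have "e \<in> Tr (S - {v})" using e by (auto simp: Tr_def)
        then show ?thesis by simp
      qed
    qed
    then have "card (Tr S) \<le> card (Tr (S - {v}) \<union> (\<lambda>(u, w). {u, w, v}) ` (N \<times> N))"
      by (rule card_mono[rotated]) (use finS finN in \<open>auto simp: Tr_def intro: finite_subset[of _ "Pow S"]\<close>)
    also have "\<dots> \<le> card (Tr (S - {v})) + card (N \<times> N)"
      using card_Un_le[of "Tr (S - {v})" "(\<lambda>(u, w). {u, w, v}) ` (N \<times> N)"]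
        card_image_le[of "N \<times> N" "\<lambda>(u, w). {u, w, v}"] finN by simp
    also have "\<dots> \<le> card (Tr (S - {v})) + k * k"
      using v(2) by (simp add: N_def card_cartesian_product mult_le_mono)
    finally have "card (Tr S) \<le> k * k * card S" using IH cS by simp
    with e show ?case by simp
  qed
  then show ?thesis unfolding Tr_def by blast
qed

text \<open>A weak sunflower: pairwise intersections lie in a kernel W of size at most c but need
  not equal it, and the sets are indexed, so repetitions are harmless. By induction on c, either s
  of the sets are pairwise disjoint, or the union of a maximal disjoint subfamily meets all other
  sets; then many of the sets share a point, which is deleted from them and added to the
  kernel.\<close>

lemma sunflower:
  "\<exists>M. \<forall>(Y :: 'b set) (F :: 'b \<Rightarrow> 'a set). finite Y \<longrightarrow> M \<le> card Y \<longrightarrow>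
     (\<forall>y\<in>Y. finite (F y) \<and> card (F y) \<le> c) \<longrightarrow>
     (\<exists>Y'\<subseteq>Y. card Y' = s \<and> (\<exists>W. finite W \<and> card W \<le> c \<and>
       (\<forall>y\<in>Y'. \<forall>y'\<in>Y'. y \<noteq> y' \<longrightarrow> F y \<inter> F y' \<subseteq> W)))"
proof (induction c)
  case 0
  show ?case
  proof (intro exI[of _ s] allI impI)
    fix Y :: "'b set" and F :: "'b \<Rightarrow> 'a set"
    assume Y: "finite Y" "s \<le> card Y" "\<forall>y\<in>Y. finite (F y) \<and> card (F y) \<le> 0"
    then obtain Y' where Y': "Y' \<subseteq> Y" "card Y' = s" by (meson obtain_subset_with_card_n)
    have "F y = {}" if "y \<in> Y'" for y
    proof -
      have "finite (F y)" "card (F y) = 0" using Y(3) Y'(1) that by auto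
      then show ?thesis by simp
    qed
    then show "\<exists>Y'\<subseteq>Y. card Y' = s \<and> (\<exists>W. finite W \<and> card W \<le> 0 \<and>
       (\<forall>y\<in>Y'. \<forall>y'\<in>Y'. y \<noteq> y' \<longrightarrow> F y \<inter> F y' \<subseteq> W))"
      using Y' by (intro exI[of _ Y'] conjI exI[of _ "{}"]) auto
  qed
next
  case (Suc c)
  then obtain M0 where M0: "\<And>Y F. \<lbrakk>finite Y; M0 \<le> card (Y :: 'b set); \<forall>y\<in>Y. finite (F y :: 'a set) \<and> card (F y) \<le> c\<rbrakk>
     \<Longrightarrow> \<exists>Y'\<subseteq>Y. card Y' = s \<and> (\<exists>W. finite W \<and> card W \<le> c \<and>
       (\<forall>y\<in>Y'. \<forall>y'\<in>Y'. y \<noteq> y' \<longrightarrow> F y \<inter> F y' \<subseteq> W))" by metis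
  show ?case
  \<comment> \<open>A maximal disjoint subfamily with fewer than s members has a union of at most s
    * Suc c points. If each of these points lay in at most M0 sets, there would be at most s + s *
    Suc c * M0 sets.\<close>
  proof (intro exI[of _ "s + s * Suc c * M0 + 1"] allI impI)
    fix Y :: "'b set" and F :: "'b \<Rightarrow> 'a set"
    assume Y: "finite Y" "s + s * Suc c * M0 + 1 \<le> card Y" and F: "\<forall>y\<in>Y. finite (F y) \<and> card (F y) \<le> Suc c"
    define D where "D = {Y0. Y0 \<subseteq> Y \<and> (\<forall>y\<in>Y0. \<forall>y'\<in>Y0. y \<noteq> y' \<longrightarrow> F y \<inter> F y' = {})}"
    have finD: "finite D" unfolding D_def using Y(1) by simp
    have "{} \<in> D" by (simp add: D_def)
    then have "Max (card ` D) \<in> card ` D" using finD by (intro Max_in) auto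
    then obtain Y0 where Y0: "Y0 \<in> D" "card Y0 = Max (card ` D)" by auto
    have mx: "card Y1 \<le> card Y0" if "Y1 \<in> D" for Y1 using that finD Y0(2) by simp
    have fin0: "finite Y0" using Y0 Y(1) finite_subset by (auto simp: D_def)
    show "\<exists>Y'\<subseteq>Y. card Y' = s \<and> (\<exists>W. finite W \<and> card W \<le> Suc c \<and>
       (\<forall>y\<in>Y'. \<forall>y'\<in>Y'. y \<noteq> y' \<longrightarrow> F y \<inter> F y' \<subseteq> W))"
    proof (cases "s \<le> card Y0")
      case True
      then obtain Y' where Y': "Y' \<subseteq> Y0" "card Y' = s" by (meson obtain_subset_with_card_n)
      moreover have "F y \<inter> F y' \<subseteq> {}" if "y \<in> Y'" "y' \<in> Y'" "y \<noteq> y'" for y y'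
        using Y0(1) that subsetD[OF Y'(1)] by (simp add: D_def)
      moreover have "Y0 \<subseteq> Y" using Y0(1) by (simp add: D_def)
      ultimately show ?thesis using Y' by (intro exI[of _ Y'] conjI exI[of _ "{}"] ballI impI) auto
    next
      case False
      define V0 where "V0 = (\<Union>y\<in>Y0. F y)"
      have F0: "finite (F y)" "card (F y) \<le> Suc c" if "y \<in> Y0" for y using that F Y0(1) by (auto simp: D_def)
      have finV: "finite V0" unfolding V0_def using fin0 F0 by auto
      have "card V0 \<le> (\<Sum>y\<in>Y0. card (F y))" unfolding V0_def by (rule card_UN_le[OF fin0])
      also have "\<dots> \<le> (\<Sum>y\<in>Y0. Suc c)" by (rule sum_mono) (use F0 in auto)
      also have "\<dots> = card Y0 * Suc c" by simp
      also have "\<dots> \<le> s * Suc c" using False by (intro mult_le_mono1) simp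
      finally have cV: "card V0 \<le> s * Suc c" .
      have hit: "F y \<inter> V0 \<noteq> {}" if "y \<in> Y" "y \<notin> Y0" for y
      proof
        assume em: "F y \<inter> V0 = {}"
        have "insert y Y0 \<in> D" using Y0(1) that em unfolding D_def V0_def by blast
        from mx[OF this] show False using that fin0 by simp
      qed
      have "\<exists>v. M0 \<le> card {y\<in>Y. v \<in> F y}"
      proof (rule ccontr)
        assume "\<not> ?thesis"
        then have small: "card {y\<in>Y. v \<in> F y} \<le> M0" for v by (meson nle_le)
        have "Y \<subseteq> Y0 \<union> (\<Union>v\<in>V0. {y\<in>Y. v \<in> F y})" using hit by blast
        then have "card Y \<le> card (Y0 \<union> (\<Union>v\<in>V0. {y\<in>Y. v \<in> F y}))"
          by (rule card_mono[rotated]) (use Y fin0 finV in auto)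
        also have "\<dots> \<le> card Y0 + card (\<Union>v\<in>V0. {y\<in>Y. v \<in> F y})" by (rule card_Un_le)
        also have "\<dots> \<le> card Y0 + (\<Sum>v\<in>V0. card {y\<in>Y. v \<in> F y})"
          using card_UN_le[OF finV] by simp
        also have "\<dots> \<le> card Y0 + (\<Sum>v\<in>V0. M0)" by (intro add_left_mono sum_mono small)
        also have "\<dots> \<le> s + s * Suc c * M0" using False cV by (simp add: add_mono mult_le_mono1 del: mult_Suc_right)
        finally show False using Y(2) by linarith
      qed
      then obtain v where v: "M0 \<le> card {y\<in>Y. v \<in> F y}" by blast
      have "\<forall>y\<in>{y\<in>Y. v \<in> F y}. finite (F y - {v}) \<and> card (F y - {v}) \<le> c" using F by auto
      from M0[OF _ v this] Y(1) obtain Y' W where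
        W: "Y' \<subseteq> {y\<in>Y. v \<in> F y}" "card Y' = s" "finite W" "card W \<le> c"
          "\<forall>y\<in>Y'. \<forall>y'\<in>Y'. y \<noteq> y' \<longrightarrow> (F y - {v}) \<inter> (F y' - {v}) \<subseteq> W" by auto
      show ?thesis
      proof (intro exI[of _ Y'] conjI exI[of _ "insert v W"])
        show "card (insert v W) \<le> Suc c" using W by (simp add: card_insert_if)
      qed (use W in blast)+
    qed
  qed
qed

text \<open>Inside the kernel W the lists do not depend on the column y; outside W, different
  columns share nothing. The index y is put into its own set because indices and list entries live
  in the same type, so that y is kept out of the lists of the other columns as well.\<close>

definition trace_sunflower :: "'b set \<Rightarrow> ('b \<Rightarrow> 'a \<Rightarrow> 'a set) \<Rightarrow> 'a set \<Rightarrow> 'a set \<Rightarrow> ('b \<Rightarrow> 'a set) \<Rightarrow> bool" where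
  "trace_sunflower X L Y W S \<longleftrightarrow>
     (\<forall>y\<in>Y. y \<notin> W \<and> (\<forall>x\<in>X. L x y \<inter> W = S x)) \<and>
     (\<forall>y\<in>Y. \<forall>y'\<in>Y. y \<noteq> y' \<longrightarrow>
        insert y (\<Union>x\<in>X. L x y) \<inter> insert y' (\<Union>x\<in>X. L x y') \<subseteq> W)"

text \<open>Apply the sunflower lemma to the sets {y} together with all entries of column y, discard
  the few y in the kernel, and use the pigeonhole principle on the traces x |-> L x y Int W.\<close>

lemma one_sided_lists:
  "\<exists>m. \<forall>(X :: 'b set) (Y :: 'a set) L. finite X \<longrightarrow> card X \<le> d \<longrightarrow> finite Y \<longrightarrow> m \<le> card Y \<longrightarrow>
     (\<forall>x\<in>X. \<forall>y\<in>Y. finite (L x y) \<and> card (L x y) \<le> c) \<longrightarrow>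
     (\<exists>Y'\<subseteq>Y. card Y' = s \<and> (\<exists>W S. trace_sunflower X L Y' W S))"
proof -
  \<comment> \<open>\<open>c'\<close> bounds the size of one such column set, hence of the kernel;
    \<open>C\<close> bounds the number of trace maps from X to subsets of the kernel.\<close>
  define c' where "c' = Suc (d * c)"
  define C :: nat where "C = (2 ^ c') ^ d"
  obtain M where M: "\<And>(Y :: 'a set) (F :: 'a \<Rightarrow> 'a set). \<lbrakk>finite Y; M \<le> card Y; \<forall>y\<in>Y. finite (F y) \<and> card (F y) \<le> c'\<rbrakk>
     \<Longrightarrow> \<exists>Y'\<subseteq>Y. card Y' = c' + C * s + 1 \<and> (\<exists>W. finite W \<and> card W \<le> c' \<and>
       (\<forall>y\<in>Y'. \<forall>y'\<in>Y'. y \<noteq> y' \<longrightarrow> F y \<inter> F y' \<subseteq> W))"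
    using sunflower[of c' "c' + C * s + 1"] by metis
  show ?thesis
  proof (intro exI[of _ M] allI impI)
    fix X :: "'b set" and Y :: "'a set" and L :: "'b \<Rightarrow> 'a \<Rightarrow> 'a set"
    assume X: "finite X" "card X \<le> d" and Y: "finite Y" "M \<le> card Y"
      and L: "\<forall>x\<in>X. \<forall>y\<in>Y. finite (L x y) \<and> card (L x y) \<le> c"
    define F where "F y = insert y (\<Union>x\<in>X. L x y)" for y
    have F: "finite (F y) \<and> card (F y) \<le> c'" if "y \<in> Y" for y
    proof
      show "finite (F y)" using X L that by (auto simp: F_def)
      have "card (\<Union>x\<in>X. L x y) \<le> (\<Sum>x\<in>X. card (L x y))" by (rule card_UN_le[OF X(1)])
      also have "\<dots> \<le> (\<Sum>x\<in>X. c)" by (rule sum_mono) (use L that in auto)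
      also have "\<dots> \<le> d * c" using X(2) by (simp add: mult_le_mono1)
      finally have le: "card (\<Union>x\<in>X. L x y) \<le> d * c" .
      have "card (F y) \<le> Suc (card (\<Union>x\<in>X. L x y))"
        unfolding F_def using X L that by (subst card_insert_if) auto
      then show "card (F y) \<le> c'" unfolding c'_def using le by simp
    qed
    then obtain Y1 W where Y1: "Y1 \<subseteq> Y" "card Y1 = c' + C * s + 1" "finite W" "card W \<le> c'"
      "\<forall>y\<in>Y1. \<forall>y'\<in>Y1. y \<noteq> y' \<longrightarrow> F y \<inter> F y' \<subseteq> W"
      using M[OF Y, of F] by blast
    define Y2 where "Y2 = Y1 - W"
    have fin2: "finite Y2" using Y1 Y finite_subset by (auto simp: Y2_def)
    have "card Y1 - card W \<le> card Y2" unfolding Y2_def by (rule diff_card_le_card_Diff[OF Y1(3)])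
    then have c2: "C * s < card Y2" using Y1 by linarith
    define \<phi> where "\<phi> y = restrict (\<lambda>x. L x y \<inter> W) X" for y
    have img: "\<phi> ` Y2 \<subseteq> X \<rightarrow>\<^sub>E Pow W" by (auto simp: \<phi>_def PiE_def)
    have finP: "finite (X \<rightarrow>\<^sub>E Pow W)" using X Y1 by (intro finite_PiE) auto
    have "card (X \<rightarrow>\<^sub>E Pow W) = (2 ^ card W) ^ card X"
      using X Y1 by (simp add: card_PiE card_Pow)
    also have "\<dots> \<le> (2 ^ c') ^ card X" by (rule power_mono) (use Y1 in \<open>auto intro: power_increasing\<close>)
    also have "\<dots> \<le> C" unfolding C_def by (rule power_increasing) (use X in auto)
    finally have "card (X \<rightarrow>\<^sub>E Pow W) * s < card Y2" using c2 by (meson le_less_trans mult_le_mono1)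
    from pigeonhole_fiber[OF fin2 img finP this] obtain S where S: "s < card {y\<in>Y2. \<phi> y = S}" by blast
    then obtain Y' where Y': "Y' \<subseteq> {y\<in>Y2. \<phi> y = S}" "card Y' = s"
      by (meson less_imp_le obtain_subset_with_card_n)
    have "L x y \<inter> W = S x" if "y \<in> Y'" "x \<in> X" for x y
    proof -
      have "\<phi> y = S" using that Y'(1) by blast
      then have "\<phi> y x = S x" by simp
      then show ?thesis using that by (simp add: \<phi>_def)
    qed
    moreover have "\<forall>y\<in>Y'. y \<notin> W" using Y' by (auto simp: Y2_def)
    moreover have "\<forall>y\<in>Y'. \<forall>y'\<in>Y'. y \<noteq> y' \<longrightarrow> F y \<inter> F y' \<subseteq> W"
      using Y' Y1(5) by (auto simp: Y2_def)
    moreover have "Y' \<subseteq> Y" using Y' Y1(1) by (auto simp: Y2_def)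
    ultimately show "\<exists>Y'\<subseteq>Y. card Y' = s \<and> (\<exists>W S. trace_sunflower X L Y' W S)"
      unfolding F_def trace_sunflower_def using Y'(2)
      by (intro exI[of _ Y'] conjI exI[of _ W] exI[of _ S]) blast+
  qed
qed

section \<open>List systems on complete bipartite graphs\<close>

text \<open>Canonical form of the lists: L x y splits into a constant part P, a part R x depending on the row,
  a part Q y depending on the column, and a part Z x y private to the pair.\<close>

definition block_lists ::
  "'a set \<Rightarrow> 'a set \<Rightarrow> ('a \<Rightarrow> 'a \<Rightarrow> 'a set) \<Rightarrow> 'a set \<Rightarrow> ('a \<Rightarrow> 'a set) \<Rightarrow> ('a \<Rightarrow> 'a set) \<Rightarrow> ('a \<Rightarrow> 'a \<Rightarrow> 'a set) \<Rightarrow> bool"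
  where
  "block_lists X Y L P R Q Z \<longleftrightarrow>
     (\<forall>x\<in>X. \<forall>y\<in>Y. L x y \<inter> (X \<union> Y) = {} \<and> L x y = P \<union> R x \<union> Q y \<union> Z x y \<and>
        P \<inter> R x = {} \<and> P \<inter> Q y = {} \<and> P \<inter> Z x y = {} \<and>
        R x \<inter> Q y = {} \<and> R x \<inter> Z x y = {} \<and> Q y \<inter> Z x y = {}) \<and>
     (\<forall>x\<in>X. \<forall>x'\<in>X. x \<noteq> x' \<longrightarrow> R x \<inter> R x' = {}) \<and>
     (\<forall>y\<in>Y. \<forall>y'\<in>Y. y \<noteq> y' \<longrightarrow> Q y \<inter> Q y' = {}) \<and>
     (\<forall>x\<in>X. \<forall>y\<in>Y. \<forall>x'\<in>X. \<forall>y'\<in>Y. (x, y) \<noteq> (x', y') \<longrightarrow> Z x y \<inter> Z x' y' = {})"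

lemma block_listsD:
  assumes "block_lists X Y L P R Q Z" "x \<in> X" "y \<in> Y"
  shows "L x y \<inter> (X \<union> Y) = {}" "L x y = P \<union> R x \<union> Q y \<union> Z x y"
    "P \<inter> R x = {}" "P \<inter> Q y = {}" "P \<inter> Z x y = {}"
    "R x \<inter> Q y = {}" "R x \<inter> Z x y = {}" "Q y \<inter> Z x y = {}"
proof -
  have "\<forall>x\<in>X. \<forall>y\<in>Y. L x y \<inter> (X \<union> Y) = {} \<and> L x y = P \<union> R x \<union> Q y \<union> Z x y \<and>
        P \<inter> R x = {} \<and> P \<inter> Q y = {} \<and> P \<inter> Z x y = {} \<and>
        R x \<inter> Q y = {} \<and> R x \<inter> Z x y = {} \<and> Q y \<inter> Z x y = {}"
    using assms(1) unfolding block_lists_def by (rule conjunct1)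
  note b = bspec[OF bspec[OF this assms(2)] assms(3)]
  show "L x y \<inter> (X \<union> Y) = {}" "L x y = P \<union> R x \<union> Q y \<union> Z x y"
    "P \<inter> R x = {}" "P \<inter> Q y = {}" "P \<inter> Z x y = {}"
    "R x \<inter> Q y = {}" "R x \<inter> Z x y = {}" "Q y \<inter> Z x y = {}"
    using b by blast+
qed

lemma block_lists_disjoint:
  assumes "block_lists X Y L P R Q Z"
  shows "x \<in> X \<Longrightarrow> x' \<in> X \<Longrightarrow> x \<noteq> x' \<Longrightarrow> R x \<inter> R x' = {}"
    and "y \<in> Y \<Longrightarrow> y' \<in> Y \<Longrightarrow> y \<noteq> y' \<Longrightarrow> Q y \<inter> Q y' = {}"
    and "x \<in> X \<Longrightarrow> y \<in> Y \<Longrightarrow> x' \<in> X \<Longrightarrow> y' \<in> Y \<Longrightarrow> (x, y) \<noteq> (x', y') \<Longrightarrow> Z x y \<inter> Z x' y' = {}"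
  using assms unfolding block_lists_def by blast+

lemma block_lists_subset:
  assumes "block_lists X Y L P R Q Z" and X': "X' \<subseteq> X" and Y': "Y' \<subseteq> Y"
  shows "block_lists X' Y' L P R Q Z"
  unfolding block_lists_def
proof (intro conjI ballI impI)
  fix x y assume xy: "x \<in> X'" "y \<in> Y'"
  note b = block_listsD[OF assms(1) subsetD[OF X' xy(1)] subsetD[OF Y' xy(2)]]
  show "L x y \<inter> (X' \<union> Y') = {}" using b(1) X' Y' by blast
  show "L x y = P \<union> R x \<union> Q y \<union> Z x y" by (rule b)
  show "P \<inter> R x = {}" "P \<inter> Q y = {}" "P \<inter> Z x y = {}"
    "R x \<inter> Q y = {}" "R x \<inter> Z x y = {}" "Q y \<inter> Z x y = {}" by (rule b)+
qed (use block_lists_disjoint[OF assms(1)] X' Y' in \<open>meson subsetD\<close>)+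

lemma block_lists_swap:
  assumes "block_lists X Y L P R Q Z"
  shows "block_lists Y X (\<lambda>y x. L x y) P Q R (\<lambda>y x. Z x y)"
  unfolding block_lists_def
proof (intro conjI ballI impI)
  fix y x assume xy: "y \<in> Y" "x \<in> X"
  note b = block_listsD[OF assms xy(2,1)]
  show "L x y \<inter> (Y \<union> X) = {}" using b(1) by blast
  show "L x y = P \<union> Q y \<union> R x \<union> Z x y" using b(2) by blast
  show "P \<inter> Q y = {}" "P \<inter> R x = {}" "P \<inter> Z x y = {}"
    "Q y \<inter> Z x y = {}" "R x \<inter> Z x y = {}" by (rule b)+
  show "Q y \<inter> R x = {}" using b(6) by blast
next
  fix y x y' x' assume "y \<in> Y" "x \<in> X" "y' \<in> Y" "x' \<in> X" "(y, x) \<noteq> (y', x')"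
  then show "Z x y \<inter> Z x' y' = {}" by (intro block_lists_disjoint(3)[OF assms]) auto
qed (use block_lists_disjoint(1,2)[OF assms] in \<open>simp_all\<close>)

text \<open>Columns are thinned out first with the rows fixed, then rows with the surviving columns
  fixed, giving kernels W and W'. Entries in W depend on the row alone and entries in W' on the
  column alone, so membership in the two kernels yields the four blocks. A last pigeonhole step
  makes the block sizes uniform.\<close>

lemma canonical_lists:
  fixes \<sigma> s :: nat
  assumes "s > 0"
  shows "\<exists>m. \<forall>(X :: 'a set) (Y :: 'a set) L. finite X \<longrightarrow> finite Y \<longrightarrow> m \<le> card X \<longrightarrow> m \<le> card Y \<longrightarrow>
     (\<forall>x\<in>X. \<forall>y\<in>Y. finite (L x y) \<and> card (L x y) = \<sigma> \<and> x \<notin> L x y \<and> y \<notin> L x y) \<longrightarrow>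
     (\<exists>X'\<subseteq>X. \<exists>Y'\<subseteq>Y. card X' = s \<and> card Y' = s \<and> (\<exists>P R Q Z. block_lists X' Y' L P R Q Z \<and>
        ((\<forall>x\<in>X'. \<forall>y\<in>Y'. Z x y \<noteq> {}) \<or> (\<forall>x\<in>X'. \<forall>y\<in>Y'. R x \<noteq> {} \<and> Q y \<noteq> {}) \<or>
         (\<forall>x\<in>X'. card P + card (R x) = \<sigma>) \<or> (\<forall>y\<in>Y'. card P + card (Q y) = \<sigma>))))"
proof -
  \<comment> \<open>Block sizes take at most Suc \<sigma> values, so one of them occurs for more
    than s of s' indices.\<close>
  define s' where "s' = Suc \<sigma> * s + 1"
  \<comment> \<open>The thresholds are fixed in the reverse order of use: the thinning of rows comes
    second and must find \<open>m2\<close> rows, so \<open>m1\<close> is chosen for column thinning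
    with that many rows.\<close>
  obtain m2 where m2: "\<forall>(X :: 'a set) (Y :: 'a set) L. finite X \<longrightarrow> card X \<le> s' \<longrightarrow> finite Y \<longrightarrow> m2 \<le> card Y \<longrightarrow>
     (\<forall>x\<in>X. \<forall>y\<in>Y. finite (L x y) \<and> card (L x y) \<le> \<sigma>) \<longrightarrow>
     (\<exists>Y'\<subseteq>Y. card Y' = s' \<and> (\<exists>W S. trace_sunflower X L Y' W S))"
    using one_sided_lists[of s' \<sigma> s'] ..
  obtain m1 where m1: "\<forall>(X :: 'a set) (Y :: 'a set) L. finite X \<longrightarrow> card X \<le> m2 \<longrightarrow> finite Y \<longrightarrow> m1 \<le> card Y \<longrightarrow>
     (\<forall>x\<in>X. \<forall>y\<in>Y. finite (L x y) \<and> card (L x y) \<le> \<sigma>) \<longrightarrow>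
     (\<exists>Y'\<subseteq>Y. card Y' = s' \<and> (\<exists>W S. trace_sunflower X L Y' W S))"
    using one_sided_lists[of m2 \<sigma> s'] ..
  show ?thesis
  proof (intro exI[of _ "max m1 m2"] allI impI)
    fix X Y :: "'a set" and L :: "'a \<Rightarrow> 'a \<Rightarrow> 'a set"
    assume fin: "finite X" "finite Y" and c: "max m1 m2 \<le> card X" "max m1 m2 \<le> card Y"
      and L: "\<forall>x\<in>X. \<forall>y\<in>Y. finite (L x y) \<and> card (L x y) = \<sigma> \<and> x \<notin> L x y \<and> y \<notin> L x y"
    obtain X0 where X0: "X0 \<subseteq> X" "card X0 = m2" using c by (meson max.bounded_iff obtain_subset_with_card_n)
    have fX0: "finite X0" using X0 fin finite_subset by blast
    have LX0: "\<forall>x\<in>X0. \<forall>y\<in>Y. finite (L x y) \<and> card (L x y) \<le> \<sigma>" using L X0 by auto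
    then obtain Y1 W S where Y1: "Y1 \<subseteq> Y" "card Y1 = s'" and tY: "trace_sunflower X0 L Y1 W S"
      using m1[rule_format, of X0 Y L] fX0 X0 c fin by auto
    have Y1': "\<And>y. y \<in> Y1 \<Longrightarrow> y \<notin> W" "\<And>x y. y \<in> Y1 \<Longrightarrow> x \<in> X0 \<Longrightarrow> L x y \<inter> W = S x"
      and WY: "\<And>y y'. \<lbrakk>y \<in> Y1; y' \<in> Y1; y \<noteq> y'\<rbrakk> \<Longrightarrow>
          insert y (\<Union>x\<in>X0. L x y) \<inter> insert y' (\<Union>x\<in>X0. L x y') \<subseteq> W"
      using tY unfolding trace_sunflower_def by simp_all
    have fY1: "finite Y1" using Y1 fin finite_subset by blast
    have "\<forall>y\<in>Y1. \<forall>x\<in>X0. finite (L x y) \<and> card (L x y) \<le> \<sigma>" using LX0 Y1 by blast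
    then obtain X1 W' S' where X1: "X1 \<subseteq> X0" "card X1 = s'"
      and tX: "trace_sunflower Y1 (\<lambda>y x. L x y) X1 W' S'"
      using m2[rule_format, of Y1 X0 "\<lambda>y x. L x y"] fX0 X0 Y1 fY1 by auto
    have X1': "\<And>x. x \<in> X1 \<Longrightarrow> x \<notin> W'" "\<And>x y. x \<in> X1 \<Longrightarrow> y \<in> Y1 \<Longrightarrow> L x y \<inter> W' = S' y"
      and WX: "\<And>x x'. \<lbrakk>x \<in> X1; x' \<in> X1; x \<noteq> x'\<rbrakk> \<Longrightarrow>
          insert x (\<Union>y\<in>Y1. L x y) \<inter> insert x' (\<Union>y\<in>Y1. L x' y) \<subseteq> W'"
      using tX unfolding trace_sunflower_def by simp_all
    have fX1: "finite X1" using X1 fX0 finite_subset by blast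
    have "X1 \<noteq> {}" "Y1 \<noteq> {}" using X1 Y1 by (auto simp: s'_def)
    then obtain x0 y0 where x0: "x0 \<in> X1" and y0: "y0 \<in> Y1" by blast
    \<comment> \<open>P consists of the entries in both kernels, which depend neither on the row nor
      on the column; R, Q and Z are the entries in W only, in W' only and in neither.\<close>
    define P where "P = S x0 \<inter> W'"
    define R where "R x = S x - W'" for x
    define Q where "Q y = S' y - W" for y
    define Z where "Z x y = L x y - W - W'" for x y
    have S: "L x y \<inter> W = S x" "L x y \<inter> W' = S' y" if "x \<in> X1" "y \<in> Y1" for x y
      using Y1'(2)[OF that(2) subsetD[OF X1(1) that(1)]] X1'(2)[OF that] by blast+
    have P: "L x y \<inter> W \<inter> W' = P" if "x \<in> X1" "y \<in> Y1" for x y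
    proof -
      have "L x y \<inter> W \<inter> W' = L x y \<inter> W' \<inter> W" by blast
      also have "\<dots> = L x0 y \<inter> W' \<inter> W" using S that x0 by simp
      also have "\<dots> = L x0 y \<inter> W \<inter> W'" by blast
      finally show ?thesis using S x0 that by (simp add: P_def)
    qed
    have Req: "R x = L x y \<inter> W - W'" if "x \<in> X1" "y \<in> Y1" for x y using S that by (simp add: R_def)
    have Qeq: "Q y = L x y \<inter> W' - W" if "x \<in> X1" "y \<in> Y1" for x y using S that by (simp add: Q_def)
    have bl: "block_lists X1 Y1 L P R Q Z"
      unfolding block_lists_def
    proof (intro conjI ballI impI)
      fix x y assume xy: "x \<in> X1" "y \<in> Y1"
      have x0': "x \<in> X0" using xy X1(1) by blast
      then have ni: "x \<notin> L x y" "y \<notin> L x y" using L X0(1) Y1(1) xy(2) by blast+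
      have "x' \<notin> L x y" if "x' \<in> X1" for x'
      proof (cases "x = x'")
        case False
        show ?thesis using WX[OF xy(1) that False] X1'(1)[OF that] xy(2) by blast
      qed (use ni in simp)
      moreover have "y' \<notin> L x y" if "y' \<in> Y1" for y'
      proof (cases "y = y'")
        case False
        show ?thesis using WY[OF xy(2) that False] Y1'(1)[OF that] x0' by blast
      qed (use ni in simp)
      ultimately show "L x y \<inter> (X1 \<union> Y1) = {}" by blast
      note e = P[OF xy, symmetric] Req[OF xy] Qeq[OF xy] Z_def
      show "L x y = P \<union> R x \<union> Q y \<union> Z x y" "P \<inter> R x = {}" "P \<inter> Q y = {}" "P \<inter> Z x y = {}"
        "R x \<inter> Q y = {}" "R x \<inter> Z x y = {}" "Q y \<inter> Z x y = {}"
        unfolding e by blast+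
    next
      fix x x' assume x: "x \<in> X1" "x' \<in> X1" "x \<noteq> x'"
      show "R x \<inter> R x' = {}" using WX[OF x] Req[OF x(1) y0] Req[OF x(2) y0] y0 by blast
    next
      fix y y' assume y: "y \<in> Y1" "y' \<in> Y1" "y \<noteq> y'"
      show "Q y \<inter> Q y' = {}" using WY[OF y] Qeq[OF x0 y(1)] Qeq[OF x0 y(2)] x0 X1(1) by blast
    next
      \<comment> \<open>Lists from different columns meet only inside W, lists from different rows
        only inside W', and Z avoids both kernels.\<close>
      fix x y x' y' assume h: "x \<in> X1" "y \<in> Y1" "x' \<in> X1" "y' \<in> Y1" "(x, y) \<noteq> (x', y')"
      show "Z x y \<inter> Z x' y' = {}"
      proof (cases "y = y'")
        case True
        then have "insert x (\<Union>y\<in>Y1. L x y) \<inter> insert x' (\<Union>y\<in>Y1. L x' y) \<subseteq> W'" using WX h by simp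
        then show ?thesis using h unfolding Z_def by blast
      next
        case False
        have "x \<in> X0" "x' \<in> X0" using h X1(1) by auto
        then show ?thesis using WY[OF h(2,4) False] unfolding Z_def by blast
      qed
    qed
    have szL: "card P + card (R x) + card (Q y) + card (Z x y) = \<sigma> \<and> card (R x) \<le> \<sigma> \<and> card (Q y) \<le> \<sigma>"
      if xy: "x \<in> X1" "y \<in> Y1" for x y
    proof -
      have "x \<in> X" "y \<in> Y" using xy X0(1) X1(1) Y1(1) by blast+
      then have L1: "finite (L x y)" "card (L x y) = \<sigma>" using L by blast+
      note b = block_listsD(2-)[OF bl xy]
      have fins: "finite P" "finite (R x)" "finite (Q y)" "finite (Z x y)" using L1(1)[unfolded b(1)] by auto
      have "card (L x y) = card P + card (R x) + card (Q y) + card (Z x y)"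
        unfolding b(1) using fins b(2-) by (simp add: card_Un_disjoint Int_Un_distrib2)
      then show ?thesis using L1 by simp
    qed
    have img: "(\<lambda>x. card (R x)) ` X1 \<subseteq> {..\<sigma>}" "(\<lambda>y. card (Q y)) ` Y1 \<subseteq> {..\<sigma>}"
      using szL[OF _ y0] szL[OF x0] by auto
    obtain q where q: "s < card {x\<in>X1. card (R x) = q}"
      using pigeonhole_fiber[OF fX1 img(1), of s] X1(2) by (auto simp: s'_def)
    obtain r where r: "s < card {y\<in>Y1. card (Q y) = r}"
      using pigeonhole_fiber[OF fY1 img(2), of s] Y1(2) by (auto simp: s'_def)
    obtain X' where X': "X' \<subseteq> {x\<in>X1. card (R x) = q}" "card X' = s"
      using q by (meson less_imp_le obtain_subset_with_card_n)
    obtain Y' where Y': "Y' \<subseteq> {y\<in>Y1. card (Q y) = r}" "card Y' = s"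
      using r by (meson less_imp_le obtain_subset_with_card_n)
    have sz: "card (R x) = q \<and> card (Q y) = r \<and> card P + q + r + card (Z x y) = \<sigma>"
      if "x \<in> X'" "y \<in> Y'" for x y using szL[of x y] X' Y' that by auto
    have "(\<forall>x\<in>X'. \<forall>y\<in>Y'. Z x y \<noteq> {}) \<or> (\<forall>x\<in>X'. \<forall>y\<in>Y'. R x \<noteq> {} \<and> Q y \<noteq> {}) \<or>
         (\<forall>x\<in>X'. card P + card (R x) = \<sigma>) \<or> (\<forall>y\<in>Y'. card P + card (Q y) = \<sigma>)"
    proof -
      obtain x1 y1 where "x1 \<in> X'" "y1 \<in> Y'" using X'(2) Y'(2) assms by fastforce
      then have le: "card P + q + r \<le> \<sigma>" using sz by fastforce
      \<comment> \<open>If P, R and Q do not exhaust the list, Z is nonempty everywhere. If they do,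
        either both R and Q are nonempty or one of them is empty and the other completes P to a full
        list.\<close>
      consider "card P + q + r < \<sigma>" | "card P + q + r = \<sigma>" "q > 0" "r > 0"
        | "card P + q = \<sigma>" | "card P + r = \<sigma>" using le by linarith
      then show ?thesis
      proof cases
        case 1
        then have "\<forall>x\<in>X'. \<forall>y\<in>Y'. Z x y \<noteq> {}" using sz by fastforce
        then show ?thesis by blast
      next
        case 2
        then have "\<forall>x\<in>X'. \<forall>y\<in>Y'. R x \<noteq> {} \<and> Q y \<noteq> {}" using sz by fastforce
        then show ?thesis by blast
      next
        case 3
        then have "\<forall>x\<in>X'. card P + card (R x) = \<sigma>" using X' by auto
        then show ?thesis by blast
      next
        case 4
        then have "\<forall>y\<in>Y'. card P + card (Q y) = \<sigma>" using Y' by auto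
        then show ?thesis by blast
      qed
    qed
    moreover have "X' \<subseteq> X1" "Y' \<subseteq> Y1" using X' Y' by auto
    moreover have "X' \<subseteq> X" "Y' \<subseteq> Y" using X' Y' X1 X0 Y1 by auto
    moreover have "block_lists X' Y' L P R Q Z" using block_lists_subset[OF bl] calculation by blast
    ultimately show "\<exists>X'\<subseteq>X. \<exists>Y'\<subseteq>Y. card X' = s \<and> card Y' = s \<and> (\<exists>P R Q Z. block_lists X' Y' L P R Q Z \<and>
        ((\<forall>x\<in>X'. \<forall>y\<in>Y'. Z x y \<noteq> {}) \<or> (\<forall>x\<in>X'. \<forall>y\<in>Y'. R x \<noteq> {} \<and> Q y \<noteq> {}) \<or>
         (\<forall>x\<in>X'. card P + card (R x) = \<sigma>) \<or> (\<forall>y\<in>Y'. card P + card (Q y) = \<sigma>)))"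
      using X'(2) Y'(2) by (intro exI[of _ X'] exI[of _ Y'] exI[of _ P] exI[of _ R] exI[of _ Q] exI[of _ Z] conjI)
  qed
qed

section \<open>Pairs of large codegree\<close>

text \<open>A lopsided Kovari-Sos-Turan argument: start with the set of all vertices of linear
  degree and pick vertices x one at a time, each keeping a fixed proportion of the current side
  Y.\<close>

lemma dense_graph_biclique:
  fixes \<epsilon> :: real
  assumes "\<epsilon> > 0"
  shows "\<exists>N. \<forall>(U :: 'a set) G. finite U \<longrightarrow> N \<le> card U \<longrightarrow> (\<forall>p\<in>G. p \<subseteq> U \<and> card p = 2) \<longrightarrow>
    \<epsilon> * (real (card U))\<^sup>2 \<le> real (card G) \<longrightarrow>
    (\<exists>X Y. X \<subseteq> U \<and> Y \<subseteq> U \<and> X \<inter> Y = {} \<and> card X = m \<and> m \<le> card Y \<and> (\<forall>x\<in>X. \<forall>y\<in>Y. {x, y} \<in> G))"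
proof -
  \<comment> \<open>Half of the density absorbs the vertices of degree below \<eta> n and the other
    half forces \<eta> n vertices above it. \<open>N\<close> makes m at most half of this degree,
    and leaves at least m vertices after m shrinkings by the factor \<eta> / 2.\<close>
  define \<eta> where "\<eta> = \<epsilon> / 2"
  have \<eta>: "\<eta> > 0" using assms by (simp add: \<eta>_def)
  define N where "N = nat \<lceil>max (2 * real m / \<eta>) (real m / ((\<eta> / 2) ^ m * \<eta>))\<rceil> + 1"
  show ?thesis
  proof (intro exI[of _ N] allI impI)
    fix U :: "'a set" and G
    assume U: "finite U" "N \<le> card U" and G: "\<forall>p\<in>G. p \<subseteq> U \<and> card p = 2"
      and dense: "\<epsilon> * (real (card U))\<^sup>2 \<le> real (card G)"
    define n where "n = real (card U)"
    have n0: "n > 0" using U by (simp add: n_def N_def)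
    have "max (2 * real m / \<eta>) (real m / ((\<eta> / 2) ^ m * \<eta>)) \<le> n"
      using U(2) unfolding N_def n_def by linarith
    then have "2 * real m / \<eta> \<le> n" "real m / ((\<eta> / 2) ^ m * \<eta>) \<le> n" by auto
    then have n1: "2 * real m \<le> \<eta> * n" and n2: "real m \<le> (\<eta> / 2) ^ m * \<eta> * n"
      using \<eta> by (simp_all add: divide_le_eq mult.commute)
    define nb where "nb y = {x\<in>U. {x, y} \<in> G}" for y
    have fnb: "finite (nb y)" for y using U by (simp add: nb_def)
    define Y0 where "Y0 = {y\<in>U. \<eta> * n \<le> card (nb y)}"
    have "card G \<le> (\<Sum>y\<in>U. card (nb y))"
    proof -
      have "G \<subseteq> (\<lambda>(y, x). {x, y}) ` (SIGMA y:U. nb y)"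
      proof
        fix p assume p: "p \<in> G"
        then obtain x y where "p = {x, y}" using G by (meson card_2_iff)
        then show "p \<in> (\<lambda>(y, x). {x, y}) ` (SIGMA y:U. nb y)"
          using p G by (auto simp: nb_def intro!: image_eqI[of _ _ "(y, x)"])
      qed
      then have "card G \<le> card (SIGMA y:U. nb y)"
        using U fnb by (meson card_image_le card_mono finite_SigmaI finite_imageI le_trans)
      then show ?thesis using U fnb by simp
    qed
    then have "\<epsilon> * n\<^sup>2 \<le> real (\<Sum>y\<in>U. card (nb y))" using dense unfolding n_def by linarith
    also have "\<dots> = (\<Sum>y\<in>U. real (card (nb y)))" by simp
    also have "\<dots> \<le> (\<Sum>y\<in>U. (if y \<in> Y0 then n else 0) + \<eta> * n)"
    proof (rule sum_mono)
      fix y assume y: "y \<in> U"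
      have "nb y \<subseteq> U" by (auto simp: nb_def)
      then have "real (card (nb y)) \<le> n" unfolding n_def using U by (simp add: card_mono)
      then show "real (card (nb y)) \<le> (if y \<in> Y0 then n else 0) + \<eta> * n"
        using y \<eta> n0 by (auto simp: Y0_def intro: add_increasing2)
    qed
    also have "\<dots> = n * card Y0 + n * (\<eta> * n)"
    proof -
      have "(\<Sum>y\<in>U. if y \<in> Y0 then n else 0) = (\<Sum>y\<in>Y0. n)"
        by (rule sum.mono_neutral_cong_right) (use U in \<open>auto simp: Y0_def\<close>)
      then show ?thesis by (simp add: sum.distrib n_def)
    qed
    finally have "n * (\<eta> * n) \<le> n * card Y0" by (simp add: \<eta>_def power2_eq_square algebra_simps)
    then have cY0: "\<eta> * n \<le> card Y0" using n0 by simp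
    have "i \<le> m \<Longrightarrow> \<exists>X Y. X \<subseteq> U \<and> Y \<subseteq> Y0 \<and> card X = i \<and> (\<eta> / 2) ^ i * \<eta> * n \<le> card Y \<and>
       (\<forall>x\<in>X. \<forall>y\<in>Y. {x, y} \<in> G)" for i
    proof (induction i)
      case 0
      show ?case using cY0 by (intro exI[of _ "{}"] exI[of _ Y0]) auto
    next
      case (Suc i)
      then obtain X Y where XY: "X \<subseteq> U" "Y \<subseteq> Y0" "card X = i" "(\<eta> / 2) ^ i * \<eta> * n \<le> card Y"
        "\<forall>x\<in>X. \<forall>y\<in>Y. {x, y} \<in> G" by auto
      have fX: "finite X" using XY(1) U(1) by (rule finite_subset)
      have "finite Y0" using U by (simp add: Y0_def)
      with XY(2) have fY: "finite Y" by (rule finite_subset)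
      have "0 < (\<eta> / 2) ^ i * \<eta> * n" using \<eta> n0 by simp
      then have cY: "real (card Y) > 0" using XY(4) by linarith
      \<comment> \<open>Averaging: every y in Y has at least \<eta> n neighbours, fewer than m of
        them in X, hence at least \<eta> n / 2 outside X.\<close>
      have "\<exists>x\<in>U - X. (\<eta> / 2) * card Y \<le> card (nb x \<inter> Y)"
      proof (rule ccontr)
        assume "\<not> ?thesis"
        then have lt: "real (card (nb x \<inter> Y)) < (\<eta> / 2) * card Y" if "x \<in> U - X" for x
          using that by force
        have swap: "(\<Sum>x\<in>U - X. real (card (nb x \<inter> Y))) = (\<Sum>y\<in>Y. real (card (nb y - X)))"
        proof -
          have "(\<Sum>x\<in>U - X. card (nb x \<inter> Y)) = (\<Sum>x\<in>U - X. card {y\<in>Y. {x, y} \<in> G})"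
            using XY(2) by (intro sum.cong refl arg_cong[of _ _ card])
              (auto simp: nb_def Y0_def insert_commute)
          also have "\<dots> = (\<Sum>y\<in>Y. card {x\<in>U - X. {x, y} \<in> G})"
            by (rule sum_multicount_gen[where k = "\<lambda>y. card {x\<in>U - X. {x, y} \<in> G}"]) (use U fY in auto)
          also have "\<dots> = (\<Sum>y\<in>Y. card (nb y - X))"
            by (intro sum.cong refl arg_cong[of _ _ card]) (auto simp: nb_def)
          finally show ?thesis by (metis of_nat_sum)
        qed
        have "card Y * (\<eta> * n / 2) = (\<Sum>y\<in>Y. \<eta> * n / 2)" by simp
        also have "\<dots> \<le> (\<Sum>y\<in>Y. real (card (nb y - X)))"
        proof (rule sum_mono)
          fix y assume "y \<in> Y"
          then have "\<eta> * n \<le> card (nb y)" using XY(2) by (auto simp: Y0_def)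
          moreover have "card (nb y) - card X \<le> card (nb y - X)" by (rule diff_card_le_card_Diff[OF fX])
          ultimately show "\<eta> * n / 2 \<le> real (card (nb y - X))" using n1 XY(3) Suc.prems by linarith
        qed
        also have "\<dots> = (\<Sum>x\<in>U - X. real (card (nb x \<inter> Y)))" using swap by simp
        finally have big: "card Y * (\<eta> * n / 2) \<le> (\<Sum>x\<in>U - X. real (card (nb x \<inter> Y)))" .
        have pos: "0 < card Y * (\<eta> * n / 2)" using cY \<eta> n0 by simp
        then have "U - X \<noteq> {}" using big by (metis leD sum.empty)
        then have "(\<Sum>x\<in>U - X. real (card (nb x \<inter> Y))) < (\<Sum>x\<in>U - X. (\<eta> / 2) * card Y)"
          using lt U by (intro sum_strict_mono) auto
        also have "\<dots> = card (U - X) * ((\<eta> / 2) * card Y)" by simp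
        also have "\<dots> \<le> n * ((\<eta> / 2) * card Y)"
          unfolding n_def using U \<eta> by (intro mult_right_mono) (auto intro: card_mono)
        finally show False using big by (simp add: algebra_simps)
      qed
      then obtain x where x: "x \<in> U" "x \<notin> X" "(\<eta> / 2) * card Y \<le> card (nb x \<inter> Y)" by blast
      have "(\<eta> / 2) ^ Suc i * \<eta> * n \<le> (\<eta> / 2) * card Y"
        using XY(4) \<eta> mult_left_mono[OF XY(4), of "\<eta> / 2"] by (simp add: algebra_simps)
      then have "(\<eta> / 2) ^ Suc i * \<eta> * n \<le> card (nb x \<inter> Y)" using x(3) by linarith
      moreover have "\<forall>x'\<in>insert x X. \<forall>y\<in>nb x \<inter> Y. {x', y} \<in> G"
        using XY(5) by (auto simp: nb_def insert_commute)
      ultimately show ?case using XY x fX by (intro exI[of _ "insert x X"] exI[of _ "nb x \<inter> Y"]) auto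
    qed
    from this[of m] obtain X Y where XY: "X \<subseteq> U" "Y \<subseteq> Y0" "card X = m"
      "(\<eta> / 2) ^ m * \<eta> * n \<le> card Y" "\<forall>x\<in>X. \<forall>y\<in>Y. {x, y} \<in> G" by auto
    have "m \<le> card Y" using XY(4) n2 by linarith
    moreover have "X \<inter> Y = {}"
    proof (rule ccontr)
      assume "X \<inter> Y \<noteq> {}"
      then obtain z where "{z, z} \<in> G" using XY(5) by blast
      then show False using G by fastforce
    qed
    ultimately show "\<exists>X Y. X \<subseteq> U \<and> Y \<subseteq> U \<and> X \<inter> Y = {} \<and> card X = m \<and> m \<le> card Y \<and> (\<forall>x\<in>X. \<forall>y\<in>Y. {x, y} \<in> G)"
      using XY by (intro exI[of _ X] exI[of _ Y]) (auto simp: Y0_def)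
  qed
qed

text \<open>The common last step of all embeddings: once the delicate edges S have their new
  vertices, the others choose greedily. The images of V, the new vertices of S and the choices for E
  - S together number at most \<open>card V + card E\<close>.\<close>

lemma complete_partial_expansion:
  assumes fin: "finite V" "finite E" and f: "inj_on f V" and S: "S \<subseteq> E" "inj_on g' S"
    and g': "\<And>e. e \<in> S \<Longrightarrow> g' e \<notin> f ` V \<and> insert (g' e) (f ` e) \<in> H"
    and C: "\<And>e. e \<in> E - S \<Longrightarrow> finite (C e) \<and> card V + card E \<le> card (C e) \<and> (\<forall>w\<in>C e. insert w (f ` e) \<in> H)"
  shows "contains_expansion H V E"
proof -
  define F where "F = f ` V \<union> g' ` S"
  have finS: "finite S" using S fin finite_subset by blast
  have finF: "finite F" using fin finS by (simp add: F_def)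
  have "card F \<le> card (f ` V) + card (g' ` S)" unfolding F_def by (rule card_Un_le)
  also have "\<dots> \<le> card V + card S" using fin finS by (intro add_mono card_image_le)
  finally have "card F + card (E - S) \<le> card V + card E"
    using card_Diff_subset[OF finS S(1)] card_mono[OF fin(2) S(1)] by linarith
  then have "\<And>e. e \<in> E - S \<Longrightarrow> finite (C e) \<and> card F + card (E - S) \<le> card (C e)"
    using C by (meson le_trans)
  then obtain g1 where g1: "inj_on g1 (E - S)" "\<And>e. e \<in> E - S \<Longrightarrow> g1 e \<in> C e - F"
    using greedy_representatives[of "E - S" F C] fin finF by blast
  define g where "g e = (if e \<in> S then g' e else g1 e)" for e
  have "inj_on g E"
  proof -
    have "inj_on g S" "inj_on g (E - S)" using g1 S by (auto simp: g_def inj_on_def)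
    moreover have "g e \<noteq> g e'" if "e \<in> S" "e' \<in> E - S" for e e'
    proof -
      have "g' e \<in> F" using that by (simp add: F_def)
      moreover have "g1 e' \<notin> F" using g1(2)[OF that(2)] by simp
      ultimately show ?thesis using that by (auto simp: g_def)
    qed
    ultimately have "inj_on g (S \<union> (E - S))" unfolding inj_on_Un by blast
    then show ?thesis using S by (simp add: Un_absorb1)
  qed
  moreover have "g e \<notin> f ` V \<and> insert (g e) (f ` e) \<in> H" if e: "e \<in> E" for e
    using g'[of e] g1(2)[of e] C[of e] e by (cases "e \<in> S") (auto simp: g_def F_def)
  ultimately show ?thesis unfolding contains_expansion_def using f by blast
qed

text \<open>Part of A goes to the constant block P, the other vertices of T to X and Y. The edges not
  meeting P are expanded inside Z, or inside R and Q after an orientation of the tree that charges every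
  vertex at most once, or inside R alone.\<close>

lemma biclique_embedding:
  fixes H :: "nat set set"
  assumes g: "grown V E" and A: "A \<subseteq> V" "\<And>e. e \<in> E \<Longrightarrow> card (A \<inter> e) = 1"
    and bl: "block_lists X Y L P R Q Z" and fin: "finite X" "finite Y" and disj: "X \<inter> Y = {}"
    and big: "card V + card E \<le> card X" "card V + card E \<le> card Y"
    and L: "\<And>x y. x \<in> X \<Longrightarrow> y \<in> Y \<Longrightarrow> finite (L x y) \<and> card (L x y) = card A"
    and H: "\<And>x y w. x \<in> X \<Longrightarrow> y \<in> Y \<Longrightarrow> w \<in> L x y \<Longrightarrow> {x, y, w} \<in> H"
    and alt: "(\<forall>x\<in>X. \<forall>y\<in>Y. Z x y \<noteq> {}) \<or> (\<forall>x\<in>X. \<forall>y\<in>Y. R x \<noteq> {} \<and> Q y \<noteq> {}) \<or>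
         (\<forall>x\<in>X. card P + card (R x) = card A)"
  shows "contains_expansion H V E"
proof -
  have finV: "finite V" and finE: "finite E" using grown_finite[OF g] by auto
  have "V \<noteq> {}" using g by (cases) auto
  then have "card V > 0" using finV by (simp add: card_gt_0_iff)
  then have "card X > 0" "card Y > 0" using big by linarith+
  then obtain x0 y0 where x0: "x0 \<in> X" and y0: "y0 \<in> Y" by (metis card_gt_0_iff ex_in_conv)
  have finA: "finite A" using A(1) finV finite_subset by blast
  have PL: "P \<subseteq> L x y" if "x \<in> X" "y \<in> Y" for x y using block_listsD(2)[OF bl that] by blast
  have finP: "finite P" and cP: "card P \<le> card A"
    using PL[OF x0 y0] L[OF x0 y0] finite_subset card_mono by metis+
  \<comment> \<open>A1 fills P completely. Hence A2 has exactly as many vertices as a list has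
    entries outside P, which the third alternative of \<open>alt\<close> relies on.\<close>
  obtain A1 where A1: "A1 \<subseteq> A" "card A1 = card P" using cP by (meson obtain_subset_with_card_n)
  have finA1: "finite A1" using A1 finA finite_subset by blast
  define A2 where "A2 = A - A1"
  have finA2: "finite A2" using finA by (simp add: A2_def)
  have cA2: "card A2 + card P = card A" unfolding A2_def using A1 finA
    by (metis card_Diff_subset cP finA1 le_add_diff_inverse2)
  obtain h where h: "inj_on h A1" "h ` A1 \<subseteq> P" using card_le_inj[OF finA1 finP] A1(2) by auto
  have "card A2 \<le> card V" unfolding A2_def using A(1) finV by (intro card_mono) auto
  then obtain i where i: "inj_on i A2" "i ` A2 \<subseteq> Y" using card_le_inj[OF finA2 fin(2)] big by auto
  have "card (V - A) \<le> card V" using finV by (intro card_mono) auto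
  then obtain j where j: "inj_on j (V - A)" "j ` (V - A) \<subseteq> X"
    using card_le_inj[of "V - A" X] finV fin big by auto
  define f where "f v = (if v \<in> A1 then h v else if v \<in> A then i v else j v)" for v
  have fA1: "f v \<in> P" if "v \<in> A1" for v using that h by (auto simp: f_def)
  have fA2: "f v \<in> Y" if "v \<in> A2" for v using that i by (auto simp: f_def A2_def)
  have fB: "f v \<in> X" if "v \<in> V - A" for v using that A1 j by (auto simp: f_def)
  have fimg: "f ` A1 \<subseteq> P" "f ` A2 \<subseteq> Y" "f ` (V - A) \<subseteq> X"
    using fA1 fA2 fB by (simp_all only: image_subset_iff) blast+
  have Vsplit: "V = A1 \<union> A2 \<union> (V - A)" using A A1 by (auto simp: A2_def)
  have PXY: "P \<inter> (X \<union> Y) = {}" using PL[OF x0 y0] block_listsD(1)[OF bl x0 y0] by blast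
  have injf: "inj_on f V"
  proof -
    have "inj_on f A1" using h(1) by (simp add: f_def inj_on_def)
    moreover have "inj_on f A2" using i(1) by (simp add: f_def inj_on_def A2_def)
    moreover have "inj_on f (V - A)"
      by (rule inj_on_cong[THEN iffD1, OF _ j(1)]) (use A1 in \<open>auto simp: f_def\<close>)
    moreover have d: "f ` A1 \<inter> f ` A2 = {}" "f ` (A1 \<union> A2) \<inter> f ` (V - A) = {}"
      unfolding image_Un using fimg PXY disj by blast+
    ultimately have "inj_on f (A1 \<union> A2)" unfolding inj_on_Un by blast
    with \<open>inj_on f (V - A)\<close> d have "inj_on f (A1 \<union> A2 \<union> (V - A))"
      unfolding inj_on_Un[of f "A1 \<union> A2"] by blast
    then show ?thesis using Vsplit by simp
  qed
  have fV: "f ` V \<subseteq> P \<union> X \<union> Y"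
    using arg_cong[OF Vsplit, of "image f"] fimg unfolding image_Un by blast
  have "\<forall>e\<in>E. \<exists>a b. e = {a, b} \<and> a \<in> A \<and> b \<in> V - A" using ind_cover_edge[OF g] A(2) by blast
  then obtain al be where ab: "\<And>e. e \<in> E \<Longrightarrow> e = {al e, be e} \<and> al e \<in> A \<and> be e \<in> V - A" by metis
  define E2 where "E2 = {e\<in>E. al e \<in> A2}"
  have finE2: "finite E2" using finE by (simp add: E2_def)
  have e2: "e = {al e, be e}" "al e \<in> A2" "be e \<in> V - A" "f (be e) \<in> X" "f (al e) \<in> Y" if "e \<in> E2" for e
    using that ab[of e] fB fA2 by (auto simp: E2_def)
  have beV: "be e \<in> V" "al e \<in> V" if "e \<in> E2" for e using ab[of e] that A by (auto simp: E2_def)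
  have fneq: "f (be e) \<noteq> f (be e') \<or> f (al e) \<noteq> f (al e')" if "e \<in> E2" "e' \<in> E2" "e \<noteq> e'" for e e'
    using that e2(1)[of e] e2(1)[of e'] injf beV by (metis inj_onD)
  \<comment> \<open>Only the edges at A2 take their new vertices from the lists. P is excluded
    because it already carries the images of A1.\<close>
  have "\<exists>g2. inj_on g2 E2 \<and> (\<forall>e\<in>E2. g2 e \<in> L (f (be e)) (f (al e)) - P)"
    using alt
  proof (elim disjE)
    assume Zne: "\<forall>x\<in>X. \<forall>y\<in>Y. Z x y \<noteq> {}"
    define g2 where "g2 e = (SOME w. w \<in> Z (f (be e)) (f (al e)))" for e
    have g2: "g2 e \<in> Z (f (be e)) (f (al e))" if "e \<in> E2" for e
      unfolding g2_def some_in_eq using bspec[OF bspec[OF Zne e2(4)[OF that]] e2(5)[OF that]] .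
    have "inj_on g2 E2"
    proof (rule inj_onI, rule ccontr)
      fix e e' assume h: "e \<in> E2" "e' \<in> E2" "g2 e = g2 e'" "e \<noteq> e'"
      have "Z (f (be e)) (f (al e)) \<inter> Z (f (be e')) (f (al e')) = {}"
        using fneq[OF h(1,2,4)] e2[OF h(1)] e2[OF h(2)] by (intro block_lists_disjoint(3)[OF bl]) auto
      then show False using g2[OF h(1)] g2[OF h(2)] h(3) by auto
    qed
    moreover have "g2 e \<in> L (f (be e)) (f (al e)) - P" if "e \<in> E2" for e
      using g2[OF that] block_listsD(2,5)[OF bl e2(4,5)[OF that]] by blast
    ultimately show ?thesis by blast
  next
    assume ne: "\<forall>x\<in>X. \<forall>y\<in>Y. R x \<noteq> {} \<and> Q y \<noteq> {}"
    \<comment> \<open>Each edge takes an element of R or Q belonging to the image of the endpoint it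
      is charged to. Different edges are charged to different vertices, and the sets R x and Q y are
      pairwise disjoint.\<close>
    obtain c where c: "inj_on c E" "\<And>e. e \<in> E \<Longrightarrow> c e \<in> e" using grown_orientation[OF g] by blast
    define g2 where "g2 e = (if c e = be e then SOME w. w \<in> R (f (be e)) else SOME w. w \<in> Q (f (al e)))" for e
    have Rs: "(SOME w. w \<in> R x) \<in> R x" if "x \<in> X" for x using ne that y0 by (metis some_in_eq)
    have Qs: "(SOME w. w \<in> Q y) \<in> Q y" if "y \<in> Y" for y using ne that x0 by (metis some_in_eq)
    have ce: "c e = be e \<or> c e = al e" if "e \<in> E2" for e
      using c(2)[of e] e2(1)[OF that] that by (auto simp: E2_def)
    have g2: "c e = be e \<and> g2 e \<in> R (f (be e)) \<or> c e = al e \<and> g2 e \<in> Q (f (al e))" if "e \<in> E2" for e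
      using ce[OF that] Rs[OF e2(4)[OF that]] Qs[OF e2(5)[OF that]] by (auto simp: g2_def)
    have cneq: "c e \<noteq> c e'" if "e \<in> E2" "e' \<in> E2" "e \<noteq> e'" for e e'
      using c(1) that by (auto simp: E2_def inj_on_def)
    have "inj_on g2 E2"
    proof (rule inj_onI, rule ccontr)
      fix e e' assume h: "e \<in> E2" "e' \<in> E2" "g2 e = g2 e'" "e \<noteq> e'"
      note cn = cneq[OF h(1,2,4)]
      have inj: "f u \<noteq> f v" if "u \<in> V" "v \<in> V" "u \<noteq> v" for u v using injf that by (auto simp: inj_on_def)
      note RQ = block_listsD(6)[OF bl]
      show False
        using g2[OF h(1)]
      proof
        assume 1: "c e = be e \<and> g2 e \<in> R (f (be e))"
        show False using g2[OF h(2)]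
        proof
          assume 2: "c e' = be e' \<and> g2 e' \<in> R (f (be e'))"
          then have "f (be e) \<noteq> f (be e')" using 1 cn beV h(1,2) by (intro inj) auto
          from block_lists_disjoint(1)[OF bl e2(4)[OF h(1)] e2(4)[OF h(2)] this]
          show False using 1 2 h(3) by auto
        next
          assume 2: "c e' = al e' \<and> g2 e' \<in> Q (f (al e'))"
          then show False using RQ[OF e2(4)[OF h(1)] e2(5)[OF h(2)]] 1 h(3) by auto
        qed
      next
        assume 1: "c e = al e \<and> g2 e \<in> Q (f (al e))"
        show False using g2[OF h(2)]
        proof
          assume 2: "c e' = be e' \<and> g2 e' \<in> R (f (be e'))"
          then show False using RQ[OF e2(4)[OF h(2)] e2(5)[OF h(1)]] 1 h(3) by auto
        next
          assume 2: "c e' = al e' \<and> g2 e' \<in> Q (f (al e'))"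
          then have "f (al e) \<noteq> f (al e')" using 1 cn beV h(1,2) by (intro inj) auto
          from block_lists_disjoint(2)[OF bl e2(5)[OF h(1)] e2(5)[OF h(2)] this]
          show False using 1 2 h(3) by auto
        qed
      qed
    qed
    moreover have "g2 e \<in> L (f (be e)) (f (al e)) - P" if "e \<in> E2" for e
      using g2[OF that] block_listsD(2,3,4)[OF bl e2(4,5)[OF that]] by blast
    ultimately show ?thesis by blast
  next
    assume cR: "\<forall>x\<in>X. card P + card (R x) = card A"
    \<comment> \<open>Edges with a common end outside A are told apart by their A2-endpoints through
      an injection into one R x; the remaining edges use disjoint sets R x.\<close>
    have "\<exists>k. inj_on k A2 \<and> k ` A2 \<subseteq> R x" if x: "x \<in> X" for x
    proof -
      have "finite (R x)" using block_listsD(2)[OF bl x y0] L[OF x y0] by (metis finite_Un)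
      moreover have "card A2 \<le> card (R x)" using cA2 cR x by fastforce
      ultimately show ?thesis using card_le_inj[OF finA2] by blast
    qed
    then obtain k where k: "\<And>x. x \<in> X \<Longrightarrow> inj_on (k x) A2 \<and> k x ` A2 \<subseteq> R x" by metis
    define g2 where "g2 e = k (f (be e)) (al e)" for e
    have g2: "g2 e \<in> R (f (be e))" if "e \<in> E2" for e
      unfolding g2_def using k[OF e2(4)[OF that]] e2(2)[OF that] by blast
    have "inj_on g2 E2"
    proof (rule inj_onI, rule ccontr)
      fix e e' assume h: "e \<in> E2" "e' \<in> E2" "g2 e = g2 e'" "e \<noteq> e'"
      show False
      proof (cases "f (be e) = f (be e')")
        case True
        then have "al e = al e'" using h(3) k[OF e2(4)[OF h(1)]] e2(2)[OF h(1)] e2(2)[OF h(2)]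
          unfolding g2_def by (metis inj_onD)
        then show False using fneq[OF h(1,2,4)] True by simp
      next
        case False
        then show False using block_lists_disjoint(1)[OF bl e2(4)[OF h(1)] e2(4)[OF h(2)] False]
            g2[OF h(1)] g2[OF h(2)] h(3) by auto
      qed
    qed
    moreover have "g2 e \<in> L (f (be e)) (f (al e)) - P" if "e \<in> E2" for e
      using g2[OF that] block_listsD(2,3)[OF bl e2(4,5)[OF that]] by blast
    ultimately show ?thesis by blast
  qed
  then obtain g2 where g2: "inj_on g2 E2" "\<And>e. e \<in> E2 \<Longrightarrow> g2 e \<in> L (f (be e)) (f (al e)) - P" by blast
  show ?thesis
  proof (rule complete_partial_expansion[OF finV finE injf, of E2 g2])
    fix e assume e: "e \<in> E2"
    have "g2 e \<notin> P \<union> X \<union> Y"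
      using g2(2)[OF e] block_listsD(1)[OF bl e2(4,5)[OF e]] by blast
    moreover have "{f (be e), f (al e), g2 e} \<in> H" using H[OF e2(4,5)[OF e]] g2(2)[OF e] by blast
    moreover have "insert (g2 e) (f ` e) = {f (be e), f (al e), g2 e}"
      by (subst e2(1)[OF e]) auto
    ultimately show "g2 e \<notin> f ` V \<and> insert (g2 e) (f ` e) \<in> H" using fV by auto
  next
    fix e assume e: "e \<in> E - E2"
    then have ae: "e = {al e, be e}" "al e \<in> A1" "be e \<in> V - A" using ab[of e] by (auto simp: E2_def A2_def)
    have "{f (be e), w, f (al e)} \<in> H" if "w \<in> Y" for w
      using fA1[OF ae(2)] fB[OF ae(3)] PL that by (intro H) auto
    moreover have "insert w (f ` e) = {f (be e), w, f (al e)}" for w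
      by (subst ae(1)) auto
    ultimately show "finite Y \<and> card V + card E \<le> card Y \<and> (\<forall>w\<in>Y. insert w (f ` e) \<in> H)"
      using fin big by simp
  qed (use g2 in \<open>auto simp: E2_def\<close>)
qed

section \<open>Codegrees in 3-graphs free of the expansion\<close>

definition completions :: "nat set set \<Rightarrow> nat set \<Rightarrow> nat set" where
  "completions H p = {w. w \<notin> p \<and> insert w p \<in> H}"

lemma few_large_codegree_pairs:
  fixes \<epsilon> :: real
  assumes g: "grown V E" and A: "A \<subseteq> V" "\<And>e. e \<in> E \<Longrightarrow> card (A \<inter> e) = 1" and \<epsilon>: "\<epsilon> > 0"
  shows "\<exists>N. \<forall>U H. finite U \<longrightarrow> N \<le> card U \<longrightarrow> \<not> contains_expansion H V E \<longrightarrow> (\<forall>e\<in>H. e \<subseteq> U) \<longrightarrow>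
    real (card {p. p \<subseteq> U \<and> card p = 2 \<and> card A \<le> card (completions H p)}) \<le> \<epsilon> * (real (card U))\<^sup>2"
proof -
  define s where "s = card V + card E"
  have "V \<noteq> {}" using g by (cases) auto
  then have "s > 0" unfolding s_def using grown_finite[OF g] by (simp add: card_gt_0_iff)
  from canonical_lists[OF this, of "card A"] obtain m where m: "\<forall>(X :: nat set) (Y :: nat set) L. finite X \<longrightarrow> finite Y \<longrightarrow> m \<le> card X \<longrightarrow> m \<le> card Y \<longrightarrow>
     (\<forall>x\<in>X. \<forall>y\<in>Y. finite (L x y) \<and> card (L x y) = card A \<and> x \<notin> L x y \<and> y \<notin> L x y) \<longrightarrow>
     (\<exists>X'\<subseteq>X. \<exists>Y'\<subseteq>Y. card X' = s \<and> card Y' = s \<and> (\<exists>P R Q Z. block_lists X' Y' L P R Q Z \<and>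
        ((\<forall>x\<in>X'. \<forall>y\<in>Y'. Z x y \<noteq> {}) \<or> (\<forall>x\<in>X'. \<forall>y\<in>Y'. R x \<noteq> {} \<and> Q y \<noteq> {}) \<or>
         (\<forall>x\<in>X'. card P + card (R x) = card A) \<or> (\<forall>y\<in>Y'. card P + card (Q y) = card A))))"
    ..
  obtain N where N: "\<forall>(U :: nat set) G. finite U \<longrightarrow> N \<le> card U \<longrightarrow> (\<forall>p\<in>G. p \<subseteq> U \<and> card p = 2) \<longrightarrow>
    \<epsilon> * (real (card U))\<^sup>2 \<le> real (card G) \<longrightarrow>
    (\<exists>X Y. X \<subseteq> U \<and> Y \<subseteq> U \<and> X \<inter> Y = {} \<and> card X = m \<and> m \<le> card Y \<and> (\<forall>x\<in>X. \<forall>y\<in>Y. {x, y} \<in> G))"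
    using dense_graph_biclique[OF \<epsilon>, of m] ..
  show ?thesis
  proof (intro exI[of _ N] allI impI)
    fix U :: "nat set" and H
    assume U: "finite U" "N \<le> card U" and free: "\<not> contains_expansion H V E" and HU: "\<forall>e\<in>H. e \<subseteq> U"
    define G where "G = {p. p \<subseteq> U \<and> card p = 2 \<and> card A \<le> card (completions H p)}"
    have "real (card G) \<le> \<epsilon> * (real (card U))\<^sup>2"
    proof (rule ccontr)
      assume "\<not> ?thesis"
      moreover have "\<forall>p\<in>G. p \<subseteq> U \<and> card p = 2" by (auto simp: G_def)
      ultimately obtain X Y where XY: "X \<subseteq> U" "Y \<subseteq> U" "X \<inter> Y = {}" "card X = m" "m \<le> card Y"
        "\<forall>x\<in>X. \<forall>y\<in>Y. {x, y} \<in> G" using N[rule_format, of U G] U by auto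
      have fin: "finite X" "finite Y" using XY U finite_subset by blast+
      have "\<exists>S. S \<subseteq> completions H {x, y} \<and> card S = card A" if "x \<in> X" "y \<in> Y" for x y
        using XY(6) that unfolding G_def by (simp, metis obtain_subset_with_card_n)
      then obtain L where L: "\<And>x y. x \<in> X \<Longrightarrow> y \<in> Y \<Longrightarrow> L x y \<subseteq> completions H {x, y} \<and> card (L x y) = card A"
        by metis
      have exU: "completions H p \<subseteq> U" for p using HU by (auto simp: completions_def)
      have Lf: "finite (L x y)" "card (L x y) = card A" "x \<notin> L x y" "y \<notin> L x y" if "x \<in> X" "y \<in> Y" for x y
      proof -
        show "finite (L x y)" using L[OF that] exU U by (meson finite_subset)
      qed (use L[OF that] in \<open>auto simp: completions_def\<close>)
      obtain X' Y' P R Q Z where X': "X' \<subseteq> X" and Y': "Y' \<subseteq> Y" and c: "card X' = s" "card Y' = s"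
        and bl: "block_lists X' Y' L P R Q Z"
        and alt: "(\<forall>x\<in>X'. \<forall>y\<in>Y'. Z x y \<noteq> {}) \<or> (\<forall>x\<in>X'. \<forall>y\<in>Y'. R x \<noteq> {} \<and> Q y \<noteq> {}) \<or>
         (\<forall>x\<in>X'. card P + card (R x) = card A) \<or> (\<forall>y\<in>Y'. card P + card (Q y) = card A)"
        using m[rule_format, of X Y L] fin XY(4,5) Lf by auto
      have fin': "finite X'" "finite Y'" using X' Y' fin finite_subset by blast+
      have LH: "{x, y, w} \<in> H" if "x \<in> X'" "y \<in> Y'" "w \<in> L x y" for x y w
      proof -
        have "insert w {x, y} \<in> H" using L[of x y] that X' Y' by (auto simp: completions_def)
        then show ?thesis by (simp add: insert_commute)
      qed
      have LL: "finite (L x y) \<and> card (L x y) = card A" if "x \<in> X'" "y \<in> Y'" for x y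
        using Lf that X' Y' by blast
      show False
      \<comment> \<open>Of the four canonical forms, \<open>biclique_embedding\<close> leaves out
        the one where P and Q y fill the list. Exchanging rows and columns turns it into the form
        with P and R.\<close>
      proof (cases "\<forall>y\<in>Y'. card P + card (Q y) = card A")
        case False
        have "contains_expansion H V E"
          by (rule biclique_embedding[OF g A bl fin']) (use X' Y' XY(3) c alt False LH LL in \<open>auto simp: s_def\<close>)
        then show False using free by simp
      next
        case True
        have "contains_expansion H V E"
        proof (rule biclique_embedding[OF g A block_lists_swap[OF bl] fin'(2,1)])
          show "{y, x, w} \<in> H" if "y \<in> Y'" "x \<in> X'" "w \<in> L x y" for y x w
            using LH[OF that(2,1,3)] by (simp add: insert_commute)
        qed (use X' Y' XY(3) c True LL in \<open>auto simp: s_def\<close>)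
        then show False using free by simp
      qed
    qed
    then show "real (card {p. p \<subseteq> U \<and> card p = 2 \<and> card A \<le> card (completions H p)}) \<le> \<epsilon> * (real (card U))\<^sup>2"
      unfolding G_def .
  qed
qed

section \<open>Heavy pairs and the double count\<close>

text \<open>A leaf can always be attached greedily, since fewer than k vertices are occupied when it
  arrives.\<close>

lemma min_degree_embedding:
  assumes "grown V E" "card V \<le> k" "S \<noteq> {}" "\<And>v. v \<in> S \<Longrightarrow> k \<le> card {u\<in>S. {u, v} \<in> G}"
  shows "\<exists>f. inj_on f V \<and> f ` V \<subseteq> S \<and> (\<forall>e\<in>E. f ` e \<in> G)"
  using assms(1,2)
proof (induction rule: grown.induct)
  case (single v)
  obtain s where "s \<in> S" using assms(3) by blast
  then show ?case by (intro exI[of _ "\<lambda>_. s"]) auto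
next
  case (leaf V E u w)
  have finV: "finite V" using grown_finite[OF leaf.hyps(1)] by simp
  have lt: "card V < k" using leaf.prems leaf.hyps(3) finV by simp
  then obtain f where f: "inj_on f V" "f ` V \<subseteq> S" "\<And>e. e \<in> E \<Longrightarrow> f ` e \<in> G" using leaf.IH by auto
  have "f u \<in> S" using f leaf.hyps(2) by blast
  then have k: "k \<le> card {x\<in>S. {x, f u} \<in> G}" by (rule assms(4))
  have "card (f ` V) < k" using card_image_le[OF finV, of f] lt by linarith
  then have "\<not> {x\<in>S. {x, f u} \<in> G} \<subseteq> f ` V"
    using k finV card_mono[of "f ` V" "{x\<in>S. {x, f u} \<in> G}"] by fastforce
  then obtain x where x: "x \<in> S" "{x, f u} \<in> G" "x \<notin> f ` V" by blast
  define f' where "f' = f(w := x)"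
  have f'V: "f' v = f v" if "v \<in> V" for v using that leaf.hyps(3) by (auto simp: f'_def)
  have "f' ` V = f ` V" using f'V by simp
  moreover have "inj_on f' V" using f(1) f'V by (simp add: inj_on_def)
  moreover have "f' w = x" by (simp add: f'_def)
  ultimately have "inj_on f' (insert w V)" "f' ` insert w V \<subseteq> S" using x f(2) leaf.hyps(3) by auto
  moreover have "f' ` e \<in> G" if "e \<in> insert {u, w} E" for e
  proof (cases "e \<in> E")
    case True
    then have "e \<subseteq> V" using grown_edge_sub[OF leaf.hyps(1)] by blast
    then have "f' ` e = f ` e" using f'V by (intro image_cong) auto
    then show ?thesis using f(3)[OF True] by simp
  next
    case False
    then have "e = {u, w}" using that by simp
    then have "f' ` e = {x, f u}" using f'V[OF leaf.hyps(2)] \<open>f' w = x\<close> by auto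
    then show ?thesis using x by simp
  qed
  ultimately show ?case by blast
qed

text \<open>\<open>K\<close> will be \<open>card V + card E\<close>, the number of completions with
  which \<open>complete_partial_expansion\<close> can finish.\<close>

definition heavy :: "nat set set \<Rightarrow> nat \<Rightarrow> nat set set" where
  "heavy H K = {p. card p = 2 \<and> K \<le> card (completions H p)}"

lemma completions_subset: "\<forall>e\<in>H. e \<subseteq> U \<Longrightarrow> completions H p \<subseteq> U"
  by (auto simp: completions_def)

lemma heavy_subset:
  assumes "\<forall>e\<in>H. e \<subseteq> U" "0 < K" "p \<in> heavy H K"
  shows "p \<subseteq> U"
proof -
  have "completions H p \<noteq> {}" using assms by (auto simp: heavy_def)
  then show ?thesis using assms(1) by (auto simp: completions_def)
qed

lemma heavy_embedding:
  assumes g: "grown V E" and U: "finite U" "\<forall>e\<in>H. e \<subseteq> U"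
    and f: "inj_on f V" "\<And>e. e \<in> E \<Longrightarrow> f ` e \<in> heavy H (card V + card E)"
  shows "contains_expansion H V E"
proof (rule complete_partial_expansion[where S = "{}" and C = "\<lambda>e. completions H (f ` e)" and g' = undefined])
  fix e assume "e \<in> E - {}"
  then show "finite (completions H (f ` e)) \<and> card V + card E \<le> card (completions H (f ` e)) \<and>
      (\<forall>w\<in>completions H (f ` e). insert w (f ` e) \<in> H)"
    using f(2)[of e] finite_subset[OF completions_subset[OF U(2)] U(1)] by (auto simp: heavy_def completions_def)
qed (use grown_finite[OF g] f in auto)

text \<open>A nonempty set of vertices with at least K heavy neighbours each inside the set would
  contain T in heavy pairs, hence its expansion in H. So the heavy graph is degenerate and peeling
  applies.\<close>

lemma heavy_degenerate:
  assumes g: "grown V E" and U: "finite U" "\<forall>e\<in>H. e \<subseteq> U" and free: "\<not> contains_expansion H V E"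
    and K: "K = card V + card E"
  shows "card (heavy H K) \<le> K * card U"
    and "card {e. e \<subseteq> U \<and> card e = 3 \<and> (\<forall>p\<subseteq>e. card p = 2 \<longrightarrow> p \<in> heavy H K)} \<le> K * K * card U"
proof -
  have "V \<noteq> {}" using g by (cases) auto
  then have K0: "0 < K" using grown_finite[OF g] K by (simp add: card_gt_0_iff)
  have "\<exists>v\<in>S. card {u\<in>S. {u, v} \<in> heavy H K} \<le> K" if Sne: "S \<noteq> {}" for S
  proof (rule ccontr)
    assume "\<not> ?thesis"
    then have "\<And>v. v \<in> S \<Longrightarrow> K \<le> card {u\<in>S. {u, v} \<in> heavy H K}" by force
    then obtain f where "inj_on f V" "\<forall>e\<in>E. f ` e \<in> heavy H K"
      using min_degree_embedding[OF g, of K S "heavy H K"] Sne K by auto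
    then show False using heavy_embedding[OF g U] free K by blast
  qed
  note dc = degenerate_card[OF U(1), of "heavy H K" K, OF _ this]
  have "{p\<in>heavy H K. p \<subseteq> U} = heavy H K" using heavy_subset[OF U(2) K0] by blast
  then show "card (heavy H K) \<le> K * card U"
    and "card {e. e \<subseteq> U \<and> card e = 3 \<and> (\<forall>p\<subseteq>e. card p = 2 \<longrightarrow> p \<in> heavy H K)} \<le> K * K * card U"
    using dc by (auto simp: heavy_def)
qed

lemma card_completions:
  assumes "card p = 2" "\<forall>e\<in>H. card e = 3"
  shows "card (completions H p) = card {e\<in>H. p \<subseteq> e}"
proof -
  have fp: "finite p" using assms(1) by (metis card.infinite zero_neq_numeral)
  have "bij_betw (\<lambda>w. insert w p) (completions H p) {e\<in>H. p \<subseteq> e}"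
  proof (rule bij_betwI')
    fix x y assume "x \<in> completions H p" "y \<in> completions H p"
    then show "(insert x p = insert y p) = (x = y)" by (auto simp: completions_def)
  next
    fix e assume e: "e \<in> {e\<in>H. p \<subseteq> e}"
    then have "card (e - p) = 1" using assms fp by (simp add: card_Diff_subset)
    then obtain w where "e - p = {w}" by (meson card_1_singletonE)
    then have "e = insert w p" "w \<notin> p" using e by auto
    then show "\<exists>x\<in>completions H p. e = insert x p" using e by (intro bexI[of _ w]) (simp_all add: completions_def)
  qed (auto simp: completions_def)
  then show ?thesis by (rule bij_betw_same_card)
qed

lemma card_pairs: "finite U \<Longrightarrow> card {p. p \<subseteq> U \<and> card p = 2} = card U choose 2"
  by (simp add: n_subsets)

text \<open>A crude quadratic bound, meant for the few vertices left over at the end: a triple is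
  either entirely heavy or contains a light pair, and a light pair lies in fewer than K
  triples.\<close>

lemma free_card_le:
  assumes g: "grown V E" and U: "finite U" "\<forall>e\<in>H. e \<subseteq> U \<and> card e = 3"
    and free: "\<not> contains_expansion H V E" and K: "K = card V + card E"
  shows "card H \<le> 2 * (K * K) * (card U * card U)"
proof -
  have HU: "\<forall>e\<in>H. e \<subseteq> U" using U by blast
  define Lt where "Lt = {p. p \<subseteq> U \<and> card p = 2 \<and> p \<notin> heavy H K}"
  have finL: "finite Lt" using U(1) by (simp add: Lt_def)
  have finH: "finite H" using U by (meson PowI finite_Pow_iff finite_subset subsetI)
  have "H \<subseteq> {e. e \<subseteq> U \<and> card e = 3 \<and> (\<forall>p\<subseteq>e. card p = 2 \<longrightarrow> p \<in> heavy H K)} \<union> (\<Union>p\<in>Lt. {e\<in>H. p \<subseteq> e})"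
  proof
    fix e assume e: "e \<in> H"
    then have "e \<subseteq> U" "card e = 3" using U(2) by auto
    then show "e \<in> {e. e \<subseteq> U \<and> card e = 3 \<and> (\<forall>p\<subseteq>e. card p = 2 \<longrightarrow> p \<in> heavy H K)} \<union> (\<Union>p\<in>Lt. {e\<in>H. p \<subseteq> e})"
      using e by (auto simp: Lt_def)
  qed
  then have "card H \<le> card ({e. e \<subseteq> U \<and> card e = 3 \<and> (\<forall>p\<subseteq>e. card p = 2 \<longrightarrow> p \<in> heavy H K)} \<union> (\<Union>p\<in>Lt. {e\<in>H. p \<subseteq> e}))"
    by (rule card_mono[rotated]) (use U finL finH in auto)
  also have "\<dots> \<le> K * K * card U + card (\<Union>p\<in>Lt. {e\<in>H. p \<subseteq> e})"
    using heavy_degenerate(2)[OF g U(1) HU free K] card_Un_le add_le_mono1 le_trans by blast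
  also have "card (\<Union>p\<in>Lt. {e\<in>H. p \<subseteq> e}) \<le> (\<Sum>p\<in>Lt. card {e\<in>H. p \<subseteq> e})" by (rule card_UN_le[OF finL])
  also have "\<dots> \<le> (\<Sum>p\<in>Lt. K)"
  proof (rule sum_mono)
    fix p assume p: "p \<in> Lt"
    then have "card {e\<in>H. p \<subseteq> e} = card (completions H p)" using card_completions[of p H] U(2) by (simp add: Lt_def)
    also have "\<dots> \<le> K" using p by (auto simp: Lt_def heavy_def)
    finally show "card {e\<in>H. p \<subseteq> e} \<le> K" .
  qed
  also have "\<dots> = card Lt * K" by simp
  also have "card Lt \<le> card U * card U"
  proof -
    have "card Lt \<le> card {p. p \<subseteq> U \<and> card p = 2}" using U(1) by (intro card_mono) (auto simp: Lt_def)
    also have "\<dots> = card U choose 2" using card_pairs[OF U(1)] .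
    also have "\<dots> \<le> card U * (card U - 1)" by (simp add: choose_two)
    also have "\<dots> \<le> card U * card U" by (intro mult_le_mono2) simp
    finally show ?thesis .
  qed
  finally have "card H \<le> K * K * card U + card U * card U * K" by simp
  moreover have "K * K * card U \<le> K * K * (card U * card U)" by (cases "card U") auto
  moreover have "card U * card U * K \<le> K * K * (card U * card U)" by (cases K) auto
  ultimately show ?thesis by linarith
qed

text \<open>In a large star with t centres, any two other vertices have all t centres as common
  heavy neighbours; poor pairs thus measure the distance from such a star.\<close>

definition poor_pairs :: "nat set \<Rightarrow> nat set set \<Rightarrow> nat \<Rightarrow> nat set set" where
  "poor_pairs U G t = {p. p \<subseteq> U \<and> card p = 2 \<and> card {w\<in>U. \<forall>u\<in>p. {u, w} \<in> G} < t}"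

text \<open>A triple that is not entirely heavy contributes at least 2 to (number of its light pairs) +
  (1 if it has exactly one light pair); a triple counted by the second summand exhibits a common
  heavy neighbour of its light pair.\<close>

lemma poor_pairs_bound:
  assumes g: "grown V E" and U: "finite U" "\<forall>e\<in>H. e \<subseteq> U \<and> card e = 3"
    and free: "\<not> contains_expansion H V E" and K: "K = card V + card E" and t: "t < K"
    and G1: "G1 = {p. p \<subseteq> U \<and> card p = 2 \<and> Suc t \<le> card (completions H p)}"
  shows "2 * card H + card (poor_pairs U (heavy H K) t)
    \<le> 2 * (K * K * card U) + 2 * t * (card U choose 2) + (2 * K + 1) * card G1"
proof -
  have HU: "\<forall>e\<in>H. e \<subseteq> U" using U by blast
  have H3: "\<forall>e\<in>H. card e = 3" using U by blast
  define Lt where "Lt = {p. p \<subseteq> U \<and> card p = 2 \<and> p \<notin> heavy H K}"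
  define Hh where "Hh = {e\<in>H. \<forall>p\<subseteq>e. card p = 2 \<longrightarrow> p \<in> heavy H K}"
  define A where "A p = {e\<in>H. p \<subseteq> e}" for p
  \<comment> \<open>The triples whose only light pair is p. Adding them to \<open>A p\<close> makes
    up the missing unit for triples with exactly one light pair.\<close>
  define B where "B p = {e\<in>H. p \<subseteq> e \<and> (\<forall>q\<subseteq>e. q \<noteq> p \<longrightarrow> q \<notin> Lt)}" for p
  let ?poor = "poor_pairs U (heavy H K) t"
  have finL: "finite Lt" using U(1) by (simp add: Lt_def)
  have finG1: "finite G1" using U(1) by (simp add: G1)
  have finpoor: "finite ?poor" using U(1) by (simp add: poor_pairs_def)
  have finH: "finite H" using U by (meson PowI finite_Pow_iff finite_subset subsetI)
  have h0: "card Hh \<le> K * K * card U"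
  proof -
    have "card Hh \<le> card {e. e \<subseteq> U \<and> card e = 3 \<and> (\<forall>p\<subseteq>e. card p = 2 \<longrightarrow> p \<in> heavy H K)}"
      using U by (intro card_mono) (auto simp: Hh_def)
    then show ?thesis using heavy_degenerate(2)[OF g U(1) HU free K] by linarith
  qed
  have two: "2 \<le> card {p\<in>Lt. e \<in> A p} + card {p\<in>Lt. e \<in> B p}" if e: "e \<in> H - Hh" for e
  proof -
    obtain p where p: "p \<in> Lt" "p \<subseteq> e" using e HU by (auto simp: Hh_def Lt_def)
    have fA: "finite {p\<in>Lt. e \<in> A p}" and fB: "finite {p\<in>Lt. e \<in> B p}" using finL by auto
    have pA: "p \<in> {p\<in>Lt. e \<in> A p}" using p e by (auto simp: A_def)
    show ?thesis
    proof (cases "e \<in> B p")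
      case True
      then have "{p\<in>Lt. e \<in> B p} \<noteq> {}" "{p\<in>Lt. e \<in> A p} \<noteq> {}" using p pA by auto
      then have "0 < card {p\<in>Lt. e \<in> B p}" "0 < card {p\<in>Lt. e \<in> A p}" using fA fB by (simp_all add: card_gt_0_iff)
      then show ?thesis by linarith
    next
      case False
      then obtain q where "q \<subseteq> e" "q \<noteq> p" "q \<in> Lt" using e p by (auto simp: B_def)
      then have "{p, q} \<subseteq> {p\<in>Lt. e \<in> A p}" "card {p, q} = 2" using pA e by (auto simp: A_def)
      then show ?thesis using card_mono[OF fA, of "{p, q}"] by simp
    qed
  qed
  have cnt: "(\<Sum>e\<in>H. card {p\<in>Lt. e \<in> F p}) = (\<Sum>p\<in>Lt. card {e\<in>H. e \<in> F p})" for F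
    by (rule sum_multicount_gen) (use finL finH in auto)
  have AB: "{e\<in>H. e \<in> A p} = A p" "{e\<in>H. e \<in> B p} = B p" for p by (auto simp: A_def B_def)
  have "2 * card (H - Hh) = (\<Sum>e\<in>H - Hh. 2)" by simp
  also have "\<dots> \<le> (\<Sum>e\<in>H - Hh. card {p\<in>Lt. e \<in> A p} + card {p\<in>Lt. e \<in> B p})"
    by (rule sum_mono) (use two in auto)
  also have "\<dots> \<le> (\<Sum>e\<in>H. card {p\<in>Lt. e \<in> A p} + card {p\<in>Lt. e \<in> B p})"
    by (rule sum_mono2) (use finH in auto)
  also have "\<dots> = (\<Sum>p\<in>Lt. card (A p) + card (B p))"
    using cnt[of A] cnt[of B] by (simp add: sum.distrib AB)
  finally have s1: "2 * card (H - Hh) \<le> (\<Sum>p\<in>Lt. card (A p) + card (B p))" .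
  \<comment> \<open>A light pair outside G1 has at most t completions, so the two counts give at
    most 2t. If it is also poor, each triple in \<open>B p\<close> yields a different common heavy
    neighbour, so \<open>B p\<close> has fewer than t members and a unit is gained. Pairs in G1 only
    obey the bound K per count, but they are few.\<close>
  have loc: "card (A p) + card (B p) + (if p \<in> ?poor - G1 then 1 else 0) \<le> 2 * t + (if p \<in> G1 then 2 * K else 0)"
    if p: "p \<in> Lt" for p
  proof -
    have p2: "card p = 2" "p \<subseteq> U" "p \<notin> heavy H K" using p by (auto simp: Lt_def)
    have "finite (A p)" using finH by (simp add: A_def)
    then have BA: "card (B p) \<le> card (A p)" by (rule card_mono) (auto simp: A_def B_def)
    have AE: "card (A p) = card (completions H p)" using card_completions[OF p2(1) H3] by (simp add: A_def)
    have AK: "card (A p) < K" using p2 by (auto simp: heavy_def AE)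
    show ?thesis
    proof (cases "p \<in> G1")
      case True
      then show ?thesis using AK BA by simp
    next
      case False
      then have At: "card (A p) \<le> t" using p2 G1 AE by auto
      show ?thesis
      proof (cases "p \<in> ?poor")
        case poor: True
        obtain x y where xy: "p = {x, y}" "x \<noteq> y" using p2(1) by (auto simp: card_2_iff)
        let ?C = "{w\<in>U. \<forall>u\<in>p. {u, w} \<in> heavy H K}"
        have "B p \<subseteq> (\<lambda>w. insert w p) ` ?C"
        proof
          fix e assume e: "e \<in> B p"
          then have eH: "e \<in> H" "p \<subseteq> e" and only: "\<And>q. q \<subseteq> e \<Longrightarrow> q \<noteq> p \<Longrightarrow> q \<notin> Lt" by (auto simp: B_def)
          have "card (e - p) = 1" using eH H3 p2 xy by (simp add: card_Diff_subset)
          then obtain w where w: "e - p = {w}" by (meson card_1_singletonE)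
          have "{u, w} \<in> heavy H K" if "u \<in> p" for u
          proof -
            have "u \<noteq> w" "{u, w} \<subseteq> e" "{u, w} \<noteq> p" using that w eH by auto
            moreover have "{u, w} \<subseteq> U" using calculation(2) eH(1) HU by blast
            ultimately show ?thesis using only[of "{u, w}"] by (auto simp: Lt_def)
          qed
          moreover have "w \<in> U" using w eH HU by blast
          moreover have "e = insert w p" using w eH by blast
          ultimately show "e \<in> (\<lambda>w. insert w p) ` ?C" by blast
        qed
        then have "card (B p) \<le> card ?C" using U(1) surj_card_le[of ?C "B p"] by simp
        also have "\<dots> < t" using poor by (simp add: poor_pairs_def)
        finally show ?thesis using At False by simp
      next
        case nb: False
        then show ?thesis using At BA False by simp
      qed
    qed
  qed
  have "(\<Sum>p\<in>Lt. card (A p) + card (B p)) + card (Lt \<inter> (?poor - G1))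
      = (\<Sum>p\<in>Lt. card (A p) + card (B p) + (if p \<in> ?poor - G1 then 1 else 0))"
    using finL by (simp add: sum.distrib sum.If_cases Int_def)
  also have "\<dots> \<le> (\<Sum>p\<in>Lt. 2 * t + (if p \<in> G1 then 2 * K else 0))"
    by (rule sum_mono) (rule loc)
  also have "\<dots> = 2 * t * card Lt + 2 * K * card (Lt \<inter> G1)"
    using finL by (simp add: sum.distrib sum.If_cases Int_def)
  also have "\<dots> \<le> 2 * t * (card U choose 2) + 2 * K * card G1"
  proof -
    have "card Lt \<le> card {p. p \<subseteq> U \<and> card p = 2}" using U(1) by (intro card_mono) (auto simp: Lt_def)
    then have "card Lt \<le> card U choose 2" using card_pairs[OF U(1)] by simp
    moreover have "card (Lt \<inter> G1) \<le> card G1" using finG1 by (intro card_mono) auto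
    ultimately show ?thesis by (intro add_mono mult_le_mono2)
  qed
  finally have s2: "(\<Sum>p\<in>Lt. card (A p) + card (B p)) + card (Lt \<inter> (?poor - G1))
     \<le> 2 * t * (card U choose 2) + 2 * K * card G1" .
  \<comment> \<open>A poor pair that is not light is heavy, and has at least K > t completions, so
    it belongs to G1.\<close>
  have "?poor \<subseteq> (Lt \<inter> (?poor - G1)) \<union> G1"
    using t by (auto simp: Lt_def G1 poor_pairs_def heavy_def)
  then have "card ?poor \<le> card ((Lt \<inter> (?poor - G1)) \<union> G1)"
    by (rule card_mono[rotated]) (use finL finG1 in auto)
  then have s3: "card ?poor \<le> card (Lt \<inter> (?poor - G1)) + card G1" using card_Un_le le_trans by blast
  have "card H = card Hh + card (H - Hh)"
    using card_Diff_subset[of Hh H] card_mono[of H Hh] finH by (auto simp: Hh_def)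
  then show ?thesis using s1 s2 s3 h0 by (simp add: algebra_simps)
qed

section \<open>Stability and the exact bound\<close>

text \<open>Only boundedly many vertices D have linear degree, almost all common neighbours lie in D, and
  almost all vertices have at most t neighbours in D; so most pairs have the same neighbours in D.\<close>

lemma common_neighbours_core:
  fixes \<epsilon> :: real
  assumes \<epsilon>: "0 < \<epsilon>" "\<epsilon> < 1" and K: "0 < K"
  shows "\<exists>N. \<forall>(U :: nat set) G. finite U \<longrightarrow> N \<le> card U \<longrightarrow> (\<forall>p\<in>G. p \<subseteq> U \<and> card p = 2) \<longrightarrow>
    card G \<le> K * card U \<longrightarrow>
    (\<forall>S\<subseteq>U. card S = Suc t \<longrightarrow> card {v\<in>U. \<forall>s\<in>S. {s, v} \<in> G} \<le> K) \<longrightarrow>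
    real (card (poor_pairs U G t)) \<le> \<epsilon> / 8 * (real (card U))\<^sup>2 \<longrightarrow>
    (\<exists>L\<subseteq>U. card L = t \<and> real (card {v\<in>U. \<not> (\<forall>l\<in>L. {l, v} \<in> G)}) \<le> \<epsilon> * real (card U))"
proof -
  \<comment> \<open>The budget is \<epsilon> n^2 bad ordered pairs: a quarter for poor pairs, a
    quarter for pairs with a common neighbour of small degree (which fixes \<delta>), and half for
    the remaining O(n) pairs (which fixes \<open>N\<close>).\<close>
  define \<delta> where "\<delta> = \<epsilon> / (8 * real K)"
  have \<delta>: "0 < \<delta>" using \<epsilon> K by (simp add: \<delta>_def)
  \<comment> \<open>Degrees sum to at most 2 K n, so at most \<open>d\<close> vertices have degree
    \<delta> n or more. A vertex with more than t neighbours among them is a common neighbour of one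
    of at most 2^d sets of size t + 1, each allowing K such vertices; this gives
    \<open>c0\<close>.\<close>
  define d where "d = nat \<lceil>2 * real K / \<delta>\<rceil>"
  define c0 where "c0 = 2 ^ d * K"
  define N where "N = nat \<lceil>2 * (2 * real c0 + 1) / \<epsilon>\<rceil> + 1"
  show ?thesis
  proof (intro exI[of _ N] allI impI)
    fix U :: "nat set" and G
    assume U: "finite U" "N \<le> card U" and G: "\<forall>p\<in>G. p \<subseteq> U \<and> card p = 2"
      and cG: "card G \<le> K * card U"
      and few: "\<forall>S\<subseteq>U. card S = Suc t \<longrightarrow> card {v\<in>U. \<forall>s\<in>S. {s, v} \<in> G} \<le> K"
      and poor: "real (card (poor_pairs U G t)) \<le> \<epsilon> / 8 * (real (card U))\<^sup>2"
    define n where "n = real (card U)"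
    have n0: "0 < n" using U by (simp add: n_def N_def)
    have "2 * (2 * real c0 + 1) / \<epsilon> \<le> n" using U(2) unfolding N_def n_def by linarith
    then have nbig: "2 * real c0 + 1 \<le> \<epsilon> / 2 * n" using \<epsilon> by (simp add: field_simps)
    have finG: "finite G" using G U by (meson PowI finite_Pow_iff finite_subset subsetI)
    define nb where "nb v = {u\<in>U. {u, v} \<in> G}" for v
    have fnb: "finite (nb v)" for v using U by (simp add: nb_def)
    have nbU: "nb v \<subseteq> U" for v by (auto simp: nb_def)
    have degsum: "(\<Sum>v\<in>U. card (nb v)) = 2 * card G"
    proof -
      have "(\<Sum>v\<in>U. card {p\<in>G. v \<in> p}) = (\<Sum>p\<in>G. card {v\<in>U. v \<in> p})"
        by (rule sum_multicount_gen) (use U finG in auto)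
      also have "\<dots> = (\<Sum>p\<in>G. 2)"
      proof (rule sum.cong[OF refl])
        fix p assume "p \<in> G"
        then have "{v\<in>U. v \<in> p} = p" "card p = 2" using G by auto
        then show "card {v\<in>U. v \<in> p} = 2" by simp
      qed
      finally have "(\<Sum>v\<in>U. card {p\<in>G. v \<in> p}) = 2 * card G" by simp
      moreover have "card (nb v) = card {p\<in>G. v \<in> p}" for v
      proof -
        have "bij_betw (\<lambda>u. {u, v}) (nb v) {p\<in>G. v \<in> p}"
        proof (rule bij_betwI')
          fix x y assume "x \<in> nb v" "y \<in> nb v"
          then show "({x, v} = {y, v}) = (x = y)" by (auto simp: doubleton_eq_iff)
        next
          fix p assume p: "p \<in> {p\<in>G. v \<in> p}"
          then have "card p = 2" "p \<subseteq> U" using G by auto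
          then obtain u where "p = {u, v}" using p by (auto simp: card_2_iff)
          then show "\<exists>x\<in>nb v. p = {x, v}" using p \<open>p \<subseteq> U\<close> by (intro bexI[of _ u]) (auto simp: nb_def)
        qed (auto simp: nb_def)
        then show ?thesis by (rule bij_betw_same_card)
      qed
      ultimately show ?thesis by simp
    qed
    have degs: "(\<Sum>v\<in>U. real (card (nb v))) \<le> 2 * real K * n"
    proof -
      have "(\<Sum>v\<in>U. real (card (nb v))) = real (2 * card G)" using degsum by (metis of_nat_sum)
      also have "\<dots> \<le> real (2 * (K * card U))" using cG by (intro of_nat_mono) simp
      finally show ?thesis by (simp add: n_def)
    qed
    define D where "D = {v\<in>U. \<delta> * n \<le> real (card (nb v))}"
    have DU: "D \<subseteq> U" by (auto simp: D_def)
    have finD: "finite D" using U by (simp add: D_def)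
    have "real (card D) * (\<delta> * n) = (\<Sum>v\<in>D. \<delta> * n)" by simp
    also have "\<dots> \<le> (\<Sum>v\<in>D. real (card (nb v)))" by (rule sum_mono) (auto simp: D_def)
    also have "\<dots> \<le> (\<Sum>v\<in>U. real (card (nb v)))" by (rule sum_mono2[OF U(1) DU]) simp
    also have "\<dots> \<le> 2 * real K * n" by (rule degs)
    finally have "real (card D) * \<delta> \<le> 2 * real K" using n0 by (simp add: mult.assoc[symmetric])
    then have "real (card D) \<le> 2 * real K / \<delta>" using \<delta> by (simp add: le_divide_eq)
    then have cD: "card D \<le> d" unfolding d_def by linarith
    define Ty where "Ty v = nb v \<inter> D" for v
    have finTy: "finite (Ty v)" for v using finD by (simp add: Ty_def)
    define B1 where "B1 = {v\<in>U. t < card (Ty v)}"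
    have finB1: "finite B1" using U by (simp add: B1_def)
    have cB1: "card B1 \<le> c0"
    proof -
      define \<S> where "\<S> = {S. S \<subseteq> D \<and> card S = Suc t}"
      have finS: "finite \<S>" using finD by (simp add: \<S>_def)
      have "B1 \<subseteq> (\<Union>S\<in>\<S>. {v\<in>U. \<forall>s\<in>S. {s, v} \<in> G})"
      proof
        fix v assume v: "v \<in> B1"
        then have "Suc t \<le> card (Ty v)" by (simp add: B1_def)
        then obtain S where "S \<subseteq> Ty v" "card S = Suc t" by (rule obtain_subset_with_card_n)
        then show "v \<in> (\<Union>S\<in>\<S>. {v\<in>U. \<forall>s\<in>S. {s, v} \<in> G})"
          using v by (auto simp: \<S>_def B1_def Ty_def nb_def)
      qed
      then have "card B1 \<le> card (\<Union>S\<in>\<S>. {v\<in>U. \<forall>s\<in>S. {s, v} \<in> G})"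
        by (rule card_mono[rotated]) (use finS U in auto)
      also have "\<dots> \<le> (\<Sum>S\<in>\<S>. card {v\<in>U. \<forall>s\<in>S. {s, v} \<in> G})" by (rule card_UN_le[OF finS])
      also have "\<dots> \<le> (\<Sum>S\<in>\<S>. K)" by (rule sum_mono) (use few DU in \<open>auto simp: \<S>_def\<close>)
      also have "\<dots> = card \<S> * K" by simp
      also have "card \<S> \<le> 2 ^ d"
      proof -
        have "card \<S> \<le> card (Pow D)" using finD by (intro card_mono) (auto simp: \<S>_def)
        also have "\<dots> = 2 ^ card D" using finD by (rule card_Pow)
        also have "\<dots> \<le> 2 ^ d" using cD by (intro power_increasing) auto
        finally show ?thesis .
      qed
      finally show ?thesis by (simp add: c0_def)
    qed
    \<comment> \<open>The bad pairs: poor ones, those with a common neighbour outside D, those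
      touching a vertex with too many neighbours in D, and the diagonal.\<close>
    define X1 where "X1 = {(u, v) \<in> U \<times> U. {u, v} \<in> poor_pairs U G t}"
    define X2 where "X2 = (\<Union>w\<in>U - D. nb w \<times> nb w)"
    define X where "X = X1 \<union> X2 \<union> (B1 \<times> U \<union> U \<times> B1) \<union> (\<lambda>u. (u, u)) ` U"
    have finX1: "finite X1" by (rule finite_subset[of _ "U \<times> U"]) (use U in \<open>auto simp: X1_def\<close>)
    have finX2: "finite X2" using U fnb by (simp add: X2_def)
    have finX: "finite X" using finX1 finX2 finB1 U by (simp add: X_def)
    have X1c: "real (card X1) \<le> \<epsilon> / 4 * n\<^sup>2"
    proof -
      have finp: "finite (poor_pairs U G t)" using U by (simp add: poor_pairs_def)
      have "card X1 \<le> (\<Sum>p\<in>poor_pairs U G t. 2)"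
      proof -
        have "X1 \<subseteq> (\<Union>p\<in>poor_pairs U G t. {(u, v). p = {u, v}})" by (auto simp: X1_def)
        moreover have pc: "finite {(u, v). p = {u, v}} \<and> card {(u, v). p = {u, v}} \<le> 2" if pp: "p \<in> poor_pairs U G t" for p
        proof -
          obtain x y where xy: "p = {x, y}" using pp by (auto simp: poor_pairs_def card_2_iff)
          have sub: "{(u, v). p = {u, v}} \<subseteq> {(x, y), (y, x)}" unfolding xy by (auto simp: doubleton_eq_iff)
          then have "card {(u, v). p = {u, v}} \<le> card {(x, y), (y, x)}" by (intro card_mono) simp_all
          also have "\<dots> \<le> 2" by (cases "x = y") simp_all
          finally have "card {(u, v). p = {u, v}} \<le> 2" .
          moreover have "finite {(u, v). p = {u, v}}" using sub by (rule finite_subset) simp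
          ultimately show ?thesis by (rule conjI[rotated])
        qed
        ultimately have "card X1 \<le> card (\<Union>p\<in>poor_pairs U G t. {(u, v). p = {u, v}})"
          by (intro card_mono) (use finp in auto)
        also have "\<dots> \<le> (\<Sum>p\<in>poor_pairs U G t. card {(u, v). p = {u, v}})" by (rule card_UN_le[OF finp])
        also have "\<dots> \<le> (\<Sum>p\<in>poor_pairs U G t. 2)" by (rule sum_mono) (use pc in blast)
        finally show ?thesis .
      qed
      then have "real (card X1) \<le> 2 * real (card (poor_pairs U G t))" by simp
      then show ?thesis using poor unfolding n_def by simp
    qed
    have X2c: "real (card X2) \<le> \<epsilon> / 4 * n\<^sup>2"
    proof -
      have "card X2 \<le> (\<Sum>w\<in>U - D. card (nb w \<times> nb w))"
        unfolding X2_def by (rule card_UN_le) (use U in simp)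
      then have "real (card X2) \<le> (\<Sum>w\<in>U - D. real (card (nb w)) * real (card (nb w)))"
        by (simp add: card_cartesian_product) (metis (mono_tags, lifting) of_nat_mono of_nat_mult of_nat_sum sum.cong)
      \<comment> \<open>One degree in each square is bounded by \<delta> n, so that the linear
        degree sum controls the sum of squares.\<close>
      also have "\<dots> \<le> (\<Sum>w\<in>U - D. \<delta> * n * real (card (nb w)))"
        by (intro sum_mono mult_right_mono) (auto simp: D_def)
      also have "\<dots> \<le> (\<Sum>w\<in>U. \<delta> * n * real (card (nb w)))"
        by (rule sum_mono2) (use U \<delta> n0 in auto)
      also have "\<dots> = \<delta> * n * (\<Sum>w\<in>U. real (card (nb w)))" by (simp add: sum_distrib_left)
      also have "\<dots> \<le> \<delta> * n * (2 * real K * n)" using degs \<delta> n0 by (intro mult_left_mono) auto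
      also have "\<dots> = \<epsilon> / 4 * n\<^sup>2" using K by (simp add: \<delta>_def power2_eq_square)
      finally show ?thesis .
    qed
    have "card X \<le> card (X1 \<union> X2) + card (B1 \<times> U \<union> U \<times> B1) + card ((\<lambda>u. (u, u)) ` U)"
      unfolding X_def by (meson add_le_mono1 card_Un_le le_trans)
    also have "\<dots> \<le> (card X1 + card X2) + (card (B1 \<times> U) + card (U \<times> B1)) + card U"
      using U by (intro add_mono card_Un_le card_image_le)
    also have "\<dots> \<le> card X1 + card X2 + 2 * (c0 * card U) + card U"
    proof -
      have "card (B1 \<times> U) \<le> c0 * card U" "card (U \<times> B1) \<le> c0 * card U"
        unfolding card_cartesian_product using mult_le_mono1[OF cB1, of "card U"]
        by (simp_all only: mult.commute)
      then show ?thesis by linarith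
    qed
    finally have "real (card X) \<le> real (card X1 + card X2 + 2 * (c0 * card U) + card U)" by (rule of_nat_mono)
    also have "\<dots> = real (card X1) + real (card X2) + (2 * real c0 + 1) * n" by (simp add: n_def algebra_simps)
    also have "\<dots> \<le> \<epsilon> / 4 * n\<^sup>2 + \<epsilon> / 4 * n\<^sup>2 + (\<epsilon> / 2 * n) * n"
      using X1c X2c nbig n0 by (intro add_mono mult_right_mono) auto
    also have "\<dots> = n * (\<epsilon> * n)" by (simp add: power2_eq_square algebra_simps)
    finally have cX: "real (card X) \<le> n * (\<epsilon> * n)" .
    have XU: "X \<subseteq> U \<times> U" using nbU by (auto simp: X_def X1_def X2_def B1_def)
    have "\<exists>u\<in>U. real (card {v\<in>U. (u, v) \<in> X}) \<le> \<epsilon> * n"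
    proof (rule ccontr)
      assume "\<not> ?thesis"
      then have big: "\<epsilon> * n < real (card {v\<in>U. (u, v) \<in> X})" if "u \<in> U" for u using that by force
      have "U \<noteq> {}" using n0 by (auto simp: n_def)
      then have "(\<Sum>u\<in>U. \<epsilon> * n) < (\<Sum>u\<in>U. real (card {v\<in>U. (u, v) \<in> X}))"
        using big U by (intro sum_strict_mono) auto
      moreover have "(\<Sum>u\<in>U. card {v\<in>U. (u, v) \<in> X}) = card X"
      proof -
        have "(\<Sum>u\<in>U. card {v\<in>U. (u, v) \<in> X}) = card (SIGMA u:U. {v\<in>U. (u, v) \<in> X})" using U by simp
        also have "(SIGMA u:U. {v\<in>U. (u, v) \<in> X}) = X" using XU by auto
        finally show ?thesis .
      qed
      ultimately have "n * (\<epsilon> * n) < real (card X)" by (simp add: n_def flip: of_nat_sum)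
      then show False using cX by simp
    qed
    then obtain u where u: "u \<in> U" "real (card {v\<in>U. (u, v) \<in> X}) \<le> \<epsilon> * n" by blast
    \<comment> \<open>A good pair has at least t common neighbours, all of them in D, while each of
      u and v has at most t neighbours in D; so both neighbourhoods in D equal the common
      one.\<close>
    have good: "Ty v = Ty u \<and> card (Ty u) = t" if v: "v \<in> U" "(u, v) \<notin> X" for v
    proof -
      have ne: "u \<noteq> v" "u \<notin> B1" "v \<notin> B1" "{u, v} \<notin> poor_pairs U G t" "(u, v) \<notin> X2"
        using v u by (auto simp: X_def X1_def)
      let ?C = "{w\<in>U. \<forall>x\<in>{u, v}. {x, w} \<in> G}"
      have "t \<le> card ?C" using ne v u by (auto simp: poor_pairs_def)
      also have "?C \<subseteq> Ty u \<inter> Ty v"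
      proof
        fix w assume w: "w \<in> ?C"
        then have "u \<in> nb w" "v \<in> nb w" "w \<in> nb u" "w \<in> nb v" using u v by (auto simp: nb_def insert_commute)
        moreover have "w \<in> D" using ne(5) w calculation unfolding X2_def by blast
        ultimately show "w \<in> Ty u \<inter> Ty v" by (simp add: Ty_def)
      qed
      then have "card ?C \<le> card (Ty u \<inter> Ty v)" using finTy by (intro card_mono) auto
      finally have c: "t \<le> card (Ty u \<inter> Ty v)" .
      have le: "card (Ty u) \<le> t" "card (Ty v) \<le> t" using ne u v by (auto simp: B1_def)
      have "Ty u \<inter> Ty v = Ty u" "Ty u \<inter> Ty v = Ty v"
        using c le finTy by (meson card_seteq inf_le1 inf_le2 le_trans)+
      then show ?thesis using c le by simp
    qed
    \<comment> \<open>Here \<epsilon> < 1 provides at least one good partner of u, which forces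
      \<open>Ty u\<close> to have exactly t elements.\<close>
    have "{v\<in>U. (u, v) \<in> X} \<noteq> U"
    proof
      assume "{v\<in>U. (u, v) \<in> X} = U"
      then have "n \<le> \<epsilon> * n" using u(2) by (simp add: n_def)
      then show False using \<epsilon> n0 by simp
    qed
    then obtain v where "v \<in> U" "(u, v) \<notin> X" by blast
    then have ct: "card (Ty u) = t" using good by blast
    have "{v\<in>U. \<not> (\<forall>l\<in>Ty u. {l, v} \<in> G)} \<subseteq> {v\<in>U. (u, v) \<in> X}"
    proof
      fix v assume v: "v \<in> {v\<in>U. \<not> (\<forall>l\<in>Ty u. {l, v} \<in> G)}"
      then have "Ty v \<noteq> Ty u" by (auto simp: Ty_def nb_def)
      then show "v \<in> {v\<in>U. (u, v) \<in> X}" using good v by auto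
    qed
    then have "card {v\<in>U. \<not> (\<forall>l\<in>Ty u. {l, v} \<in> G)} \<le> card {v\<in>U. (u, v) \<in> X}"
      using U by (intro card_mono) auto
    then have "real (card {v\<in>U. \<not> (\<forall>l\<in>Ty u. {l, v} \<in> G)}) \<le> \<epsilon> * n" using u(2) by linarith
    then show "\<exists>L\<subseteq>U. card L = t \<and> real (card {v\<in>U. \<not> (\<forall>l\<in>L. {l, v} \<in> G)}) \<le> \<epsilon> * real (card U)"
      using ct DU unfolding n_def by (intro exI[of _ "Ty u"]) (auto simp: Ty_def)
  qed
qed

section \<open>Comparison with a star\<close>

definition star_on :: "nat set \<Rightarrow> nat set \<Rightarrow> nat set set" where
  "star_on U L = {e. e \<subseteq> U \<and> card e = 3 \<and> e \<inter> L \<noteq> {}}"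

lemma star3_star_on: "star3 n t = star_on {1..n} {1..t}"
  by (auto simp: star3_def triples_def star_on_def)

lemma card_star_on:
  assumes "finite U" "L \<subseteq> U"
  shows "card (star_on U L) = (card U choose 3) - ((card U - card L) choose 3)"
proof -
  have "star_on U L = {e. e \<subseteq> U \<and> card e = 3} - {e. e \<subseteq> U - L \<and> card e = 3}"
    by (auto simp: star_on_def)
  then have "card (star_on U L) = card {e. e \<subseteq> U \<and> card e = 3} - card {e. e \<subseteq> U - L \<and> card e = 3}"
    using assms(1) by (subst card_Diff_subset[symmetric]) auto
  then show ?thesis using assms by (simp add: n_subsets card_Diff_subset finite_subset)
qed

text \<open>It suffices to count the triples with exactly one vertex in {1..t}; replacing n - t by n
  in the binomial coefficient costs at most t n for each centre.\<close>

lemma card_star3_ge: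
  assumes "t \<le> n"
  shows "t * (n choose 2) \<le> card (star3 n t) + t * t * n"
proof -
  define P where "P = {p. p \<subseteq> {Suc t..n} \<and> card p = 2}"
  have "inj_on (\<lambda>(i, p). insert i p) ({1..t} \<times> P)"
  proof (rule inj_onI, clarify)
    fix i p j q assume h: "i \<in> {1..t}" "p \<in> P" "j \<in> {1..t}" "q \<in> P" "insert i p = insert j q"
    then have "i \<notin> q" "j \<notin> p" "i \<notin> p" "j \<notin> q" by (auto simp: P_def)
    then show "i = j \<and> p = q" using h(5) by (metis insertE insertI1 insert_ident)
  qed
  then have "t * card P = card ((\<lambda>(i, p). insert i p) ` ({1..t} \<times> P))"
    by (simp add: card_image card_cartesian_product)
  also have "\<dots> \<le> card (star3 n t)"
  proof (rule card_mono)
    show "finite (star3 n t)" by (simp add: star3_def triples_def)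
    show "(\<lambda>(i, p). insert i p) ` ({1..t} \<times> P) \<subseteq> star3 n t"
    proof clarify
      fix i p assume ip: "i \<in> {1..t}" "p \<in> P"
      then have "i \<notin> p" "finite p" "p \<subseteq> {1..n}" by (auto simp: P_def intro: finite_subset)
      then show "insert i p \<in> star3 n t" using ip assms by (auto simp: star3_def triples_def P_def)
    qed
  qed
  finally have "t * ((n - t) choose 2) \<le> card (star3 n t)" by (simp add: P_def n_subsets)
  moreover have "n choose 2 \<le> ((n - t) choose 2) + t * n"
  proof -
    obtain r where r: "n = r + t" using assms by (metis add.commute le_iff_add)
    have "(r + t) choose 2 \<le> (r choose 2) + t * (r + t)"
    proof (induction t)
      case (Suc t)
      have "(r + Suc t) choose 2 = ((r + t) choose 2) + (r + t)"
        by (simp add: numeral_2_eq_2)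
      then show ?case using Suc by (simp add: algebra_simps)
    qed simp
    then show ?thesis using r by simp
  qed
  then have "t * (n choose 2) \<le> t * ((n - t) choose 2) + t * (t * n)"
    by (metis add_mult_distrib2 mult_le_mono2)
  ultimately show ?thesis by (simp add: mult.assoc)
qed

text \<open>The triple e realises the pendant edge: its vertices x, y, z are the leaf a, its
  neighbour b and the new vertex. All other edges run between L and W and are heavy, so they are
  expanded greedily. The summand 3 in \<open>K + 3\<close> leaves room in W off e for the remaining
  vertices of V - A.\<close>

lemma leaf_embedding:
  assumes g: "grown V E" and A: "A \<subseteq> V" "\<And>e. e \<in> E \<Longrightarrow> card (A \<inter> e) = 1"
    and ab: "a \<in> A" "b \<in> V - A" "{e\<in>E. a \<in> e} = {{a, b}}"
    and U: "finite U" "\<forall>e\<in>H. e \<subseteq> U" and K: "K = card V + card E"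
    and L: "finite L" "Suc (card L) = card A"
    and W: "finite W" "W \<inter> L = {}" "\<And>l v. l \<in> L \<Longrightarrow> v \<in> W \<Longrightarrow> {l, v} \<in> heavy H K" "K + 3 \<le> card W"
    and e: "e \<in> H" "card e = 3" "e \<inter> L = {}" "y \<in> e" "y \<in> W"
  shows "contains_expansion H V E"
proof -
  have finV: "finite V" and finE: "finite E" using grown_finite[OF g] by auto
  have finA: "finite A" using A(1) finV finite_subset by blast
  have fe: "finite e" using e(2) by (metis card.infinite zero_neq_numeral)
  have "card (e - {y}) = 2" using e fe by simp
  then obtain x z where xz: "e - {y} = {x, z}" "x \<noteq> z" by (auto simp: card_2_iff)
  then have exyz: "e = {x, y, z}" "x \<noteq> y" "z \<noteq> y" using e(4) by auto
  have "card (A - {a}) \<le> card L" using L ab(1) finA by simp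
  then obtain h where h: "inj_on h (A - {a})" "h ` (A - {a}) \<subseteq> L"
    using card_le_inj[OF _ L(1)] finA by (metis finite_Diff)
  define B where "B = V - A - {b}"
  have "card B \<le> card V" using finV by (intro card_mono) (auto simp: B_def)
  moreover have "card W - card e \<le> card (W - e)" by (rule diff_card_le_card_Diff[OF fe])
  ultimately have "card B \<le> card (W - e)" using W(4) e(2) K by linarith
  then obtain i where i: "inj_on i B" "i ` B \<subseteq> W - e"
    using card_le_inj[of B "W - e"] finV W(1) by (auto simp: B_def)
  define f where "f v = (if v = a then x else if v = b then y else if v \<in> A then h v else i v)" for v
  have anb: "a \<noteq> b" using ab by auto
  have fa: "f a = x" and fb: "f b = y" using anb by (auto simp: f_def)
  have fA: "f v = h v" "f v \<in> L" if "v \<in> A - {a}" for v using that ab(2) h(2) by (auto simp: f_def)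
  have fB: "f v = i v" "f v \<in> W - e" if "v \<in> B" for v using that ab(1) i(2) by (auto simp: f_def B_def)
  have V: "V = {a} \<union> {b} \<union> (A - {a}) \<union> B" using A ab by (auto simp: B_def)
  have iA: "f ` (A - {a}) \<subseteq> L" using fA(2) by (simp only: image_subset_iff) blast
  have iB: "f ` B \<subseteq> W - e" using fB(2) by (simp only: image_subset_iff) blast
  have xe: "x \<in> e" "y \<in> e" "z \<in> e" using exyz by auto
  have injf: "inj_on f V"
  proof -
    have 1: "inj_on f (A - {a})" by (rule inj_on_cong[THEN iffD1, OF _ h(1)]) (simp add: fA)
    have 2: "inj_on f B" by (rule inj_on_cong[THEN iffD1, OF _ i(1)]) (simp add: fB)
    have 3: "inj_on f ({a} \<union> {b})" using fa fb exyz by (auto simp: inj_on_def)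
    have i3: "f ` ({a} \<union> {b}) \<subseteq> e" using fa fb xe by simp
    have 4: "inj_on f ({a} \<union> {b} \<union> (A - {a}))"
      unfolding inj_on_Un[of f "{a} \<union> {b}"] using 1 3 i3 iA e(3) by blast
    have i4: "f ` ({a} \<union> {b} \<union> (A - {a})) \<subseteq> e \<union> L" using i3 iA unfolding image_Un by blast
    have "inj_on f ({a} \<union> {b} \<union> (A - {a}) \<union> B)"
      unfolding inj_on_Un[of f "{a} \<union> {b} \<union> (A - {a})"] using 2 4 i4 iB W(2) by blast
    then show ?thesis using V by simp
  qed
  have zV: "z \<notin> f ` V"
  proof
    assume "z \<in> f ` V"
    then obtain v where v: "v \<in> V" "z = f v" by blast
    then consider "v = a" | "v = b" | "v \<in> A - {a}" | "v \<in> B" using V by blast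
    then show False
    proof cases
      case 3
      then show False using fA(2)[OF 3] v xe e(3) by auto
    next
      case 4
      then show False using fB(2)[OF 4] v xe by auto
    qed (use v fa fb xz exyz in auto)
  qed
  show ?thesis
  proof (rule complete_partial_expansion[OF finV finE injf, of "{{a, b}}" "\<lambda>_. z" H "\<lambda>e. completions H (f ` e)"])
    show "{{a, b}} \<subseteq> E" using ab(3) by auto
    fix e' assume "e' \<in> {{a, b}}"
    moreover have "insert z (f ` {a, b}) = e" using fa fb exyz by auto
    ultimately show "z \<notin> f ` V \<and> insert z (f ` e') \<in> H" using zV e(1) by simp
  next
    fix e' assume e': "e' \<in> E - {{a, b}}"
    then have "a \<notin> e'" using ab(3) by auto
    obtain a' b' where a'b': "e' = {a', b'}" "a' \<in> A" "b' \<in> V - A"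
      using ind_cover_edge[OF g _ A(2)] e' by blast
    have "f a' \<in> L" using a'b' \<open>a \<notin> e'\<close> by (intro fA(2)) auto
    moreover have "f b' \<in> W"
    proof (cases "b' = b")
      case True
      then show ?thesis using fb e(5) by simp
    next
      case False
      then show ?thesis using fB(2)[of b'] a'b' by (simp add: B_def)
    qed
    ultimately have "f ` e' \<in> heavy H K" using W(3) a'b'(1) by simp
    then show "finite (completions H (f ` e')) \<and> card V + card E \<le> card (completions H (f ` e')) \<and>
        (\<forall>w\<in>completions H (f ` e'). insert w (f ` e') \<in> H)"
      using finite_subset[OF completions_subset[OF U(2)] U(1)] K by (auto simp: heavy_def completions_def)
  qed auto
qed

lemma contains_expansion_mono:
  "contains_expansion H' V E \<Longrightarrow> H' \<subseteq> H \<Longrightarrow> contains_expansion H V E"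
  unfolding contains_expansion_def by blast

text \<open>With r vertices in R and n in U, at most 2 K^2 r^2 triples of H miss L, while at least r
  (n - K - 2) / 3 triples of the star are absent from H. The constant 12 gives 6 K^2 r <= n / 2 <= n
  - K - 2, so the trade never favours H.\<close>

lemma near_star_bound:
  assumes g: "grown V E" and A: "A \<subseteq> V" "\<And>e. e \<in> E \<Longrightarrow> card (A \<inter> e) = 1"
    and ab: "a \<in> A" "b \<in> V - A" "{e\<in>E. a \<in> e} = {{a, b}}"
    and U: "finite U" "\<forall>e\<in>H. e \<subseteq> U \<and> card e = 3" "2 * K + 6 \<le> card U"
    and free: "\<not> contains_expansion H V E" and K: "K = card V + card E"
    and L: "L \<subseteq> U" "Suc (card L) = card A"
    and near: "12 * (K * K) * card {v\<in>U. \<not> (\<forall>l\<in>L. {l, v} \<in> heavy H K)} \<le> card U"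
  shows "card H \<le> card (star_on U L)"
proof -
  have HU: "\<forall>e\<in>H. e \<subseteq> U" using U by blast
  have finH: "finite H" using U by (meson PowI finite_Pow_iff finite_subset subsetI)
  have finL: "finite L" using L U finite_subset by blast
  have "V \<noteq> {}" using g by (cases) auto
  then have K0: "0 < K" using grown_finite[OF g] K by (simp add: card_gt_0_iff)
  define W where "W = {v\<in>U. \<forall>l\<in>L. {l, v} \<in> heavy H K}"
  define R' where "R' = {v\<in>U. \<not> (\<forall>l\<in>L. {l, v} \<in> heavy H K)}"
  \<comment> \<open>Vertices of L always land in \<open>R'\<close>, because {l, l} has one element
    and is never heavy; they must not count as exceptional.\<close>
  define R where "R = R' - L"
  have finR: "finite R" "finite R'" using U by (auto simp: R_def R'_def)
  have WL: "W \<inter> L = {}"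
  proof (rule ccontr)
    assume "W \<inter> L \<noteq> {}"
    then obtain l where "l \<in> L" "\<forall>l'\<in>L. {l', l} \<in> heavy H K" by (auto simp: W_def)
    then have "{l, l} \<in> heavy H K" by blast
    then show False by (simp add: heavy_def)
  qed
  have near': "12 * (K * K) * card R' \<le> card U" using near by (simp add: R'_def)
  have "1 \<le> K * K" using K0 by simp
  then have "12 * card R' \<le> 12 * (K * K) * card R'" by simp
  then have R'n: "12 * card R' \<le> card U" using near' by linarith
  have WR: "W = U - R'" by (auto simp: W_def R'_def)
  moreover have "R' \<subseteq> U" by (auto simp: R'_def)
  ultimately have cW: "card W = card U - card R'" using finR by (simp add: card_Diff_subset)
  then have W3: "K + 3 \<le> card W" using R'n U(3) by linarith
  define St where "St = star_on U L"
  have finSt: "finite St" by (rule finite_subset[of _ "Pow U"]) (use U in \<open>auto simp: St_def star_on_def\<close>)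
  have out: "e \<subseteq> R" if e: "e \<in> H - St" for e
  proof -
    have e3: "e \<subseteq> U" "card e = 3" "e \<inter> L = {}" using e U(2) by (auto simp: St_def star_on_def)
    have "e \<inter> W = {}"
    proof (rule ccontr)
      assume "e \<inter> W \<noteq> {}"
      then obtain y where y: "y \<in> e" "y \<in> W" by blast
      have "contains_expansion H V E"
      proof (rule leaf_embedding[OF g A ab U(1) HU K finL L(2)])
        show "finite W" using U by (simp add: W_def)
        show "W \<inter> L = {}" by (rule WL)
        show "{l, v} \<in> heavy H K" if "l \<in> L" "v \<in> W" for l v using that by (simp add: W_def)
        show "K + 3 \<le> card W" by (rule W3)
        show "e \<in> H" using e by simp
      qed (use e3 y in auto)
      then show False using free by simp
    qed
    then show ?thesis using e3 unfolding R_def WR by blast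
  qed
  have "card (H - St) \<le> 2 * (K * K) * (card R * card R)"
  proof (rule free_card_le[OF g finR(1) _ _ K])
    show "\<forall>e\<in>H - St. e \<subseteq> R \<and> card e = 3" using out U(2) by blast
    show "\<not> contains_expansion (H - St) V E" using free contains_expansion_mono by blast
  qed
  moreover have "card R * (card U - (K + 2)) \<le> 3 * card (St - H)"
  proof -
    \<comment> \<open>Some l in L forms a light pair with y, so fewer than K triples through l and y
      belong to H; all the others are missing star triples.\<close>
    have miss: "card U - (K + 2) \<le> card {e\<in>St - H. y \<in> e}" if y: "y \<in> R" for y
    proof -
      obtain l where l: "l \<in> L" "{l, y} \<notin> heavy H K" "y \<in> U" "y \<notin> L" using y by (auto simp: R_def R'_def)
      then have ly: "l \<noteq> y" "l \<in> U" using L by auto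
      have finx: "finite (completions H {l, y})" using completions_subset[OF HU] U finite_subset by blast
      define Q where "Q = U - (completions H {l, y} \<union> {l, y})"
      have "card (completions H {l, y}) < K" using l ly by (simp add: heavy_def)
      then have "card (completions H {l, y} \<union> {l, y}) \<le> K + 2"
        using card_Un_le[of "completions H {l, y}" "{l, y}"] ly by simp
      then have "card U - (K + 2) \<le> card Q" unfolding Q_def
        using diff_card_le_card_Diff[of "completions H {l, y} \<union> {l, y}" U] finx by simp
      also have "card Q = card ((\<lambda>v. insert v {l, y}) ` Q)"
      proof -
        have "inj_on (\<lambda>v. insert v {l, y}) Q" by (auto simp: inj_on_def Q_def)
        then show ?thesis by (simp add: card_image)
      qed
      also have "\<dots> \<le> card {e\<in>St - H. y \<in> e}"
      proof (rule card_mono)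
        show "(\<lambda>v. insert v {l, y}) ` Q \<subseteq> {e\<in>St - H. y \<in> e}"
          using l ly by (auto simp: Q_def St_def star_on_def completions_def)
      qed (use finSt in simp)
      finally show ?thesis .
    qed
    have "card R * (card U - (K + 2)) = (\<Sum>y\<in>R. card U - (K + 2))" by simp
    also have "\<dots> \<le> (\<Sum>y\<in>R. card {e\<in>St - H. y \<in> e})" by (rule sum_mono) (rule miss)
    also have "\<dots> = (\<Sum>e\<in>St - H. card {y\<in>R. y \<in> e})"
      by (rule sum_multicount_gen) (use finR finSt in auto)
    \<comment> \<open>A missing triple is counted once for each of its vertices in R, hence at most
      three times.\<close>
    also have "\<dots> \<le> (\<Sum>e\<in>St - H. 3)"
    proof (rule sum_mono)
      fix e assume "e \<in> St - H"
      then have e3: "card e = 3" by (auto simp: St_def star_on_def)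
      then have "finite e" by (metis card.infinite zero_neq_numeral)
      then have "card {y\<in>R. y \<in> e} \<le> card e" by (intro card_mono) auto
      then show "card {y\<in>R. y \<in> e} \<le> 3" using e3 by simp
    qed
    finally show ?thesis by simp
  qed
  moreover have "2 * (K * K) * (card R * card R) * 3 \<le> card R * (card U - (K + 2))"
  proof -
    have "card R \<le> card R'" using finR by (intro card_mono) (auto simp: R_def)
    then have "12 * (K * K) * card R \<le> card U" using near' by (meson le_trans mult_le_mono2)
    then have "6 * (K * K) * card R \<le> card U - (K + 2)" using U(3) by linarith
    then have "card R * (6 * (K * K) * card R) \<le> card R * (card U - (K + 2))" by (rule mult_le_mono2)
    also have "card R * (6 * (K * K) * card R) = 2 * (K * K) * (card R * card R) * 3"
      by (simp only: mult_ac)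
    finally show ?thesis .
  qed
  ultimately have out_le: "card (H - St) \<le> card (St - H)" by linarith
  have "card H = card (H \<inter> St) + card (H - St)" using finH by (metis card_Int_Diff)
  moreover have "card St = card (H \<inter> St) + card (St - H)" using finSt by (metis card_Int_Diff inf_commute)
  ultimately show ?thesis using out_le by (simp add: St_def)
qed

text \<open>With more than K common neighbours, A fits on S and V - A among the neighbours, a copy
  of T in heavy pairs. With \<open>card A\<close> = t + 1 this is the hypothesis on sets of size
  \<open>Suc t\<close> in \<open>common_neighbours_core\<close>.\<close>

lemma heavy_common_neighbours:
  assumes g: "grown V E" and A: "A \<subseteq> V" "\<And>e. e \<in> E \<Longrightarrow> card (A \<inter> e) = 1"
    and U: "finite U" "\<forall>e\<in>H. e \<subseteq> U" and free: "\<not> contains_expansion H V E"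
    and K: "K = card V + card E" and S: "S \<subseteq> U" "card S = card A"
  shows "card {v\<in>U. \<forall>s\<in>S. {s, v} \<in> heavy H K} \<le> K"
proof (rule ccontr)
  let ?C = "{v\<in>U. \<forall>s\<in>S. {s, v} \<in> heavy H K}"
  assume "\<not> ?thesis"
  then have big: "K < card ?C" by simp
  have finV: "finite V" using grown_finite[OF g] by simp
  have finA: "finite A" using A(1) finV finite_subset by blast
  have finS: "finite S" using S U finite_subset by blast
  have "card (V - A) \<le> card V" using finV by (intro card_mono) auto
  then have "card (V - A) \<le> card ?C" using big K by linarith
  then obtain j where j: "inj_on j (V - A)" "j ` (V - A) \<subseteq> ?C"
    using card_le_inj[of "V - A" ?C] finV U by auto
  obtain h where h: "inj_on h A" "h ` A \<subseteq> S" using card_le_inj[OF finA finS] S by auto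
  define f where "f v = (if v \<in> A then h v else j v)" for v
  have SC: "S \<inter> ?C = {}" by (auto simp: heavy_def)
  have fA: "f ` A \<subseteq> S" using h by (auto simp: f_def)
  have "f ` (V - A) = j ` (V - A)" by (rule image_cong) (auto simp: f_def)
  then have fB: "f ` (V - A) \<subseteq> ?C" using j by simp
  have 1: "inj_on f A" by (rule inj_on_cong[THEN iffD1, OF _ h(1)]) (simp add: f_def)
  have 2: "inj_on f (V - A)" by (rule inj_on_cong[THEN iffD1, OF _ j(1)]) (simp add: f_def)
  have "inj_on f (A \<union> (V - A))" unfolding inj_on_Un using 1 2 fA fB SC by blast
  moreover have "A \<union> (V - A) = V" using A by blast
  ultimately have injf: "inj_on f V" by simp
  have "f ` e \<in> heavy H (card V + card E)" if e: "e \<in> E" for e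
  proof -
    obtain a b where e': "e = {a, b}" "a \<in> A" "b \<in> V - A" using ind_cover_edge[OF g e A(2)[OF e]] by blast
    have "f a \<in> S" using fA e'(2) by blast
    moreover have "f b \<in> ?C" using fB e'(3) by blast
    ultimately show ?thesis using e'(1) K by auto
  qed
  then show False using heavy_embedding[OF g U injf] free by blast
qed

lemma expansion_turan_bound:
  assumes g: "grown V E" and A: "A \<subseteq> V" "\<And>e. e \<in> E \<Longrightarrow> card (A \<inter> e) = 1"
    and ab: "a \<in> A" "b \<in> V - A" "{e\<in>E. a \<in> e} = {{a, b}}"
  shows "\<exists>N. \<forall>n\<ge>N. \<forall>H\<subseteq>triples n. \<not> contains_expansion H V E \<longrightarrow> card H \<le> card (star3 n (card A - 1))"
proof -
  have finV: "finite V" and finE: "finite E" using grown_finite[OF g] by auto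
  have finA: "finite A" using A(1) finV finite_subset by blast
  define K where "K = card V + card E"
  define t where "t = card A - 1"
  have cA: "card A = Suc t" using ab(1) finA by (metis Suc_pred' card_gt_0_iff empty_iff t_def)
  have tK: "t < K" using cA card_mono[OF finV A(1)] by (simp add: K_def)
  then have K0: "0 < K" by simp
  \<comment> \<open>The proportion of exceptional vertices that \<open>near_star_bound\<close>
    tolerates.\<close>
  define \<epsilon> where "\<epsilon> = 1 / (12 * (real K * real K))"
  have "1 \<le> real K * real K" using K0 by (simp flip: of_nat_mult)
  then have \<epsilon>: "0 < \<epsilon>" "\<epsilon> < 1" by (simp_all add: \<epsilon>_def)
  \<comment> \<open>The allowance \<epsilon> / 8 for poor pairs is split evenly: \<epsilon> / 16 for
    the term (2K + 1) |G1|, fixed by this choice, and \<epsilon> / 16 for the terms linear in n,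
    fixed by \<open>N3\<close>.\<close>
  define \<epsilon>1 where "\<epsilon>1 = \<epsilon> / (16 * (2 * real K + 1))"
  have \<epsilon>1: "0 < \<epsilon>1" using \<epsilon> by (simp add: \<epsilon>1_def)
  obtain N1 where N1: "\<forall>(U :: nat set) G. finite U \<longrightarrow> N1 \<le> card U \<longrightarrow> (\<forall>p\<in>G. p \<subseteq> U \<and> card p = 2) \<longrightarrow>
    card G \<le> K * card U \<longrightarrow>
    (\<forall>S\<subseteq>U. card S = Suc t \<longrightarrow> card {v\<in>U. \<forall>s\<in>S. {s, v} \<in> G} \<le> K) \<longrightarrow>
    real (card (poor_pairs U G t)) \<le> \<epsilon> / 8 * (real (card U))\<^sup>2 \<longrightarrow>
    (\<exists>L\<subseteq>U. card L = t \<and> real (card {v\<in>U. \<not> (\<forall>l\<in>L. {l, v} \<in> G)}) \<le> \<epsilon> * real (card U))"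
    using common_neighbours_core[OF \<epsilon> K0, of t] ..
  obtain N2 where N2: "\<forall>U H. finite U \<longrightarrow> N2 \<le> card U \<longrightarrow> \<not> contains_expansion H V E \<longrightarrow> (\<forall>e\<in>H. e \<subseteq> U) \<longrightarrow>
    real (card {p. p \<subseteq> U \<and> card p = 2 \<and> card A \<le> card (completions H p)}) \<le> \<epsilon>1 * (real (card U))\<^sup>2"
    using few_large_codegree_pairs[OF g A \<epsilon>1] ..
  define N3 where "N3 = nat \<lceil>16 * (2 * real (K * K) + 2 * real (t * t)) / \<epsilon>\<rceil>"
  show ?thesis
  proof (intro exI[of _ "N1 + N2 + N3 + (2 * K + 6)"] allI impI)
    fix n H assume n: "N1 + N2 + N3 + (2 * K + 6) \<le> n" and Hn: "H \<subseteq> triples n"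
      and free: "\<not> contains_expansion H V E"
    define U where "U = {1..n}"
    have U: "finite U" "card U = n" by (auto simp: U_def)
    have H: "\<forall>e\<in>H. e \<subseteq> U \<and> card e = 3" using Hn by (auto simp: triples_def U_def)
    then have HU: "\<forall>e\<in>H. e \<subseteq> U" by blast
    have tn: "t \<le> n" using tK n by linarith
    show "card H \<le> card (star3 n (card A - 1))"
    proof (rule ccontr)
      assume "\<not> ?thesis"
      then have big: "card (star3 n t) < card H" by (simp add: t_def)
      define G1 where "G1 = {p. p \<subseteq> U \<and> card p = 2 \<and> Suc t \<le> card (completions H p)}"
      have G1: "real (card G1) \<le> \<epsilon>1 * (real n)\<^sup>2"
        using N2[rule_format, of U H] U n free HU cA by (simp add: G1_def)
      have "2 * card H + card (poor_pairs U (heavy H K) t)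
        \<le> 2 * (K * K * n) + 2 * t * (n choose 2) + (2 * K + 1) * card G1"
        using poor_pairs_bound[OF g U(1) H free K_def tK G1_def] U by simp
      \<comment> \<open>Only here does H exceeding the star matter: the main terms 2 |H| and 2 t (n
        choose 2) cancel up to O(n), leaving a bound on the poor pairs alone.\<close>
      moreover have "t * (n choose 2) \<le> card H + t * t * n" using card_star3_ge[OF tn] big by linarith
      ultimately have "card (poor_pairs U (heavy H K) t)
        \<le> 2 * (K * K * n) + 2 * (t * t * n) + (2 * K + 1) * card G1" by linarith
      then have "real (card (poor_pairs U (heavy H K) t))
        \<le> real (2 * (K * K * n) + 2 * (t * t * n) + (2 * K + 1) * card G1)" by (rule of_nat_mono)
      also have "\<dots> = (2 * real (K * K) + 2 * real (t * t)) * real n + (2 * real K + 1) * real (card G1)"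
        by (simp add: algebra_simps)
      also have "\<dots> \<le> (\<epsilon> / 16 * real n) * real n + (2 * real K + 1) * (\<epsilon>1 * (real n)\<^sup>2)"
      proof (intro add_mono mult_right_mono mult_left_mono G1)
        have "16 * (2 * real (K * K) + 2 * real (t * t)) / \<epsilon> \<le> real n"
          using n unfolding N3_def by linarith
        then show "2 * real (K * K) + 2 * real (t * t) \<le> \<epsilon> / 16 * real n"
          using \<epsilon> by (simp add: field_simps)
      qed auto
      also have "\<dots> = \<epsilon> / 8 * (real n)\<^sup>2"
        by (simp add: \<epsilon>1_def power2_eq_square field_simps)
      finally have poor: "real (card (poor_pairs U (heavy H K) t)) \<le> \<epsilon> / 8 * (real (card U))\<^sup>2"
        using U by simp
      have "\<exists>L\<subseteq>U. card L = t \<and> real (card {v\<in>U. \<not> (\<forall>l\<in>L. {l, v} \<in> heavy H K)}) \<le> \<epsilon> * real (card U)"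
      proof (rule N1[rule_format, OF U(1) _ _ _ _ poor])
        show "N1 \<le> card U" using U n by simp
        show "p \<subseteq> U \<and> card p = 2" if "p \<in> heavy H K" for p
          using heavy_subset[OF HU K0 that] that by (simp add: heavy_def)
        show "card (heavy H K) \<le> K * card U" by (rule heavy_degenerate(1)[OF g U(1) HU free K_def])
        show "card {v\<in>U. \<forall>s\<in>S. {s, v} \<in> heavy H K} \<le> K" if "S \<subseteq> U" "card S = Suc t" for S
          using heavy_common_neighbours[OF g A U(1) HU free K_def that(1)] that(2) cA by simp
      qed
      then obtain L where L: "L \<subseteq> U" "card L = t"
        "real (card {v\<in>U. \<not> (\<forall>l\<in>L. {l, v} \<in> heavy H K)}) \<le> \<epsilon> * real (card U)" by blast
      have "card H \<le> card (star_on U L)"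
      proof (rule near_star_bound[OF g A ab U(1) H _ free K_def L(1)])
        show "2 * K + 6 \<le> card U" using n U by simp
        show "Suc (card L) = card A" using L cA by simp
        have "12 * (real K * real K) * real (card {v\<in>U. \<not> (\<forall>l\<in>L. {l, v} \<in> heavy H K)}) \<le> real (card U)"
          using L(3) K0 by (simp add: \<epsilon>_def field_simps)
        then have "real (12 * (K * K) * card {v\<in>U. \<not> (\<forall>l\<in>L. {l, v} \<in> heavy H K)}) \<le> real (card U)" by simp
        then show "12 * (K * K) * card {v\<in>U. \<not> (\<forall>l\<in>L. {l, v} \<in> heavy H K)} \<le> card U"
          by (simp only: of_nat_le_iff)
      qed
      also have "card (star_on U L) = card (star3 n t)"
      proof -
        have "{1..t} \<subseteq> U" using tn by (auto simp: U_def)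
        then show ?thesis
          unfolding star3_star_on U_def[symmetric] using card_star_on[OF U(1)] L by simp
      qed
      finally show False using big by simp
    qed
  qed
qed

section \<open>The extremal number\<close>

lemma finite_triples: "finite (triples n)"
  by (simp add: triples_def)

lemma finite_ex_candidates: "finite {card H | H. H \<subseteq> triples n \<and> \<not> contains_expansion H V E}"
  by (rule finite_subset[of _ "card ` Pow (triples n)"]) (auto simp: finite_triples)

theorem theorem1p2:
  fixes V :: "'a set" and E :: "'a set set"
  assumes "is_tree V E"
  shows "(crosscut V E = ind_cover_number V E \<and> (\<exists>e\<in>E. critical_edge V E e) \<longrightarrow>
            (\<exists>N. \<forall>n\<ge>N. ex_exp3 n V E \<le> card (star3 n (crosscut V E - 1))))
       \<and> (strongly_edge_critical V E \<longrightarrow>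
            (\<exists>N. \<forall>n\<ge>N. ex_exp3 n V E = card (star3 n (crosscut V E - 1))))"
proof -
  have g: "grown V E" using assms by (rule tree_grown)
  have upper: "\<exists>N. \<forall>n\<ge>N. ex_exp3 n V E \<le> card (star3 n (crosscut V E - 1))"
    if h: "crosscut V E = ind_cover_number V E" "\<exists>e\<in>E. critical_edge V E e"
  proof -
    obtain e0 where e0: "e0 \<in> E" "crosscut V (E - {e0}) < crosscut V E"
      using h(2) by (auto simp: critical_edge_def)
    obtain A where A: "A \<subseteq> V" "\<forall>e\<in>E. card (A \<inter> e) = 1" "card A = crosscut V E"
      using ind_cover_attained[OF g] h(1) by auto
    have A1: "card (A \<inter> e) = 1" if "e \<in> E" for e using A(2) that by blast
    obtain a b where ab: "a \<in> A" "{e\<in>E. a \<in> e} = {{a, b}}" "b \<in> V - A"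
      using ind_cover_has_leaf[OF g A(1) A1 e0(1)] e0(2) A(3) by auto
    obtain N where N: "\<forall>n\<ge>N. \<forall>H\<subseteq>triples n. \<not> contains_expansion H V E \<longrightarrow> card H \<le> card (star3 n (card A - 1))"
      using expansion_turan_bound[OF g A(1) A1 ab(1,3,2)] ..
    have "ex_exp3 n V E \<le> card (star3 n (crosscut V E - 1))" if n: "N \<le> n" for n
    proof -
      \<comment> \<open>T has an edge, so the empty 3-graph is free of the expansion and the maximum
        in \<open>ex_exp3\<close> is over a nonempty set.\<close>
      have "\<not> contains_expansion {} V E" using e0(1) by (auto simp: contains_expansion_def)
      then have "{card H | H. H \<subseteq> triples n \<and> \<not> contains_expansion H V E} \<noteq> {}" by blast
      then show ?thesis unfolding ex_exp3_def
        using N n A(3) by (subst Max_le_iff[OF finite_ex_candidates]) auto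
    qed
    then show ?thesis by blast
  qed
  moreover have "\<exists>N. \<forall>n\<ge>N. ex_exp3 n V E = card (star3 n (crosscut V E - 1))"
    if s: "strongly_edge_critical V E"
  proof -
    have sc: "cover_number V E = crosscut V E" "crosscut V E = ind_cover_number V E"
      "\<exists>e\<in>E. critical_edge V E e" using s by (auto simp: strongly_edge_critical_def)
    \<comment> \<open>The critical edge makes the crosscut number positive, so the truncated
      subtraction really lowers it.\<close>
    then have "crosscut V E - 1 < cover_number V E" by (auto simp: critical_edge_def)
    then have "\<not> contains_expansion (star3 n (crosscut V E - 1)) V E" for n
      by (rule star3_no_expansion[OF g])
    moreover have "star3 n (crosscut V E - 1) \<subseteq> triples n" for n by (auto simp: star3_def)
    ultimately have "card (star3 n (crosscut V E - 1)) \<le> ex_exp3 n V E" for n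
      unfolding ex_exp3_def by (intro Max_ge finite_ex_candidates) blast
    then show ?thesis using upper[OF sc(2,3)] by (meson le_antisym)
  qed
  ultimately show ?thesis by blast
qed

end
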